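(* Let $a,b,c\in\mathbb{C}$ with $a,b\ne 0$, let $h(z)=ae^z+bz+c$, and let $$N_h(z)=z-\frac{h(z)}{h'(z)}=\frac{z-1-\alpha e^{-z}}{1+\beta e^{-z}},\qquad \alpha=\frac{c}{a},\quad \beta=\frac{b}{a},$$ be its Newton's method. If the asymptotic value $u=-c/b=-\alpha/\beta$ of $N_h$ satisfies $$\inf_{n\ge 0}\operatorname{dist}\left(N_h^n(u),J(N_h)\right)>0,$$ then $N_h$ has no wandering domains.
   Context: $N_h$ is regarded as a meromorphic map $\mathbb{C}\to\widehat{\mathbb{C}}$. For a meromorphic map $f:\mathbb{C}\to\widehat{\mathbb{C}}$, the Fatou set $F(f)$ is the set of points having a neighborhood on which all iterates $f^n$, $n>0$, are well defined and form a normal family; the Julia set is $J(f)=\widehat{\mathbb{C}}\setminus F(f)$. A Fatou component is a connected component of $F(f)$. For a Fatou component $U$, let $U_n$ be the Fatou component containing $f^n(U)$; $U$ is a wandering domain if it is neither periodic nor preperiodic, i.e. $U_n\ne U_m$ for all $n\ne m$. $\operatorname{dist}$ is the Euclidean distance (so the distance to $J(N_h)$ means the distance to $J(N_h)\cap\mathbb{C}$); the hypothesis on $u$ includes that all iterates $N_h^n(u)$ are defined and finite. *)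

theory Defs
  imports "HOL-Complex_Analysis.Complex_Analysis"
begin

subsection \<open>The Riemann sphere\<close>

datatype riemann_sphere = Fin (fin_part: complex) | Infty

text \<open>Stereographic projection to the unit sphere of \<open>\<complex> \<times> \<real>\<close>; pulling the Euclidean distance
  back along it gives the chordal (spherical) metric, so that \<open>open\<close>, \<open>components\<close> and
  \<open>uniform_limit\<close> on \<^typ>\<open>riemann_sphere\<close> are the usual notions for the Riemann sphere.\<close>

fun stereo :: "riemann_sphere \<Rightarrow> complex \<times> real" where
  "stereo (Fin z) = (of_real (2 / (1 + (cmod z)\<^sup>2)) * z, 1 - 2 / (1 + (cmod z)\<^sup>2))"
| "stereo Infty = (0, 1)"

lemma one_plus_cmod_sq_pos: "1 + (cmod z)\<^sup>2 > 0"
  by (rule add_pos_nonneg) auto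

lemma stereo_eq_iff [simp]: "stereo p = stereo q \<longleftrightarrow> p = q"
proof
  assume eq: "stereo p = stereo q"
  show "p = q"
  proof (cases p; cases q)
    fix z w assume p: "p = Fin z" and q: "q = Fin w"
    have e: "2 / (1 + (cmod z)\<^sup>2) = 2 / (1 + (cmod w)\<^sup>2)"
      using eq p q by simp
    have "2 / (1 + (cmod z)\<^sup>2) \<noteq> 0"
      using one_plus_cmod_sq_pos[of z] by simp
    moreover have "of_real (2 / (1 + (cmod z)\<^sup>2)) * z = of_real (2 / (1 + (cmod z)\<^sup>2)) * w"
      using eq p q e by (metis fst_conv stereo.simps(1))
    ultimately have "z = w"
      by (metis mult_left_cancel of_real_eq_0_iff)
    with p q show ?thesis by simp
  next
    fix z assume "p = Fin z" "q = Infty"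
    then have "2 / (1 + (cmod z)\<^sup>2) = 0" using eq by simp
    then show ?thesis using one_plus_cmod_sq_pos[of z] by simp
  next
    fix z assume "p = Infty" "q = Fin z"
    then have "2 / (1 + (cmod z)\<^sup>2) = 0" using eq by simp
    then show ?thesis using one_plus_cmod_sq_pos[of z] by simp
  qed simp
qed simp

instantiation riemann_sphere :: metric_space
begin

definition dist_riemann_sphere :: "riemann_sphere \<Rightarrow> riemann_sphere \<Rightarrow> real" where
  "dist_riemann_sphere p q = dist (stereo p) (stereo q)"

definition uniformity_riemann_sphere :: "(riemann_sphere \<times> riemann_sphere) filter" where
  "uniformity_riemann_sphere = (INF e\<in>{0 <..}. principal {(x, y). dist x y < e})"

definition open_riemann_sphere :: "riemann_sphere set \<Rightarrow> bool" where
  "open_riemann_sphere U \<longleftrightarrow> (\<forall>x\<in>U. \<forall>\<^sub>F (x', y) in uniformity. x' = x \<longrightarrow> y \<in> U)"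

instance
proof
  fix p q r :: riemann_sphere
  show "dist p q = 0 \<longleftrightarrow> p = q"
    by (simp add: dist_riemann_sphere_def)
  show "dist p q \<le> dist p r + dist q r"
    unfolding dist_riemann_sphere_def by (rule dist_triangle2)
qed (fact uniformity_riemann_sphere_def open_riemann_sphere_def)+

end

subsection \<open>Meromorphic maps and their iterates\<close>

text \<open>The map into the sphere induced by a meromorphic function given by a formula; the value at
  a removable singularity is the limit there.\<close>

definition sphere_map :: "(complex \<Rightarrow> complex) \<Rightarrow> complex \<Rightarrow> riemann_sphere" where
  "sphere_map g z = (if is_pole g z then Infty else Fin (remove_sings g z))"

definition newton_map :: "(complex \<Rightarrow> complex) \<Rightarrow> complex \<Rightarrow> riemann_sphere" where
  "newton_map h = sphere_map (\<lambda>z. z - h z / deriv h z)"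

text \<open>A map \<open>f\<close> from \<open>\<complex>\<close> to the sphere is undefined at infinity, so its \<open>n\<close>-th iterate is defined
  at \<open>p\<close> only if none of the earlier iterates of \<open>p\<close> is infinity. The function \<open>iter f n\<close> is total,
  with the dummy value infinity where the iterate is undefined.\<close>

definition iter :: "(complex \<Rightarrow> riemann_sphere) \<Rightarrow> nat \<Rightarrow> riemann_sphere \<Rightarrow> riemann_sphere" where
  "iter f n = (\<lambda>p. case p of Fin z \<Rightarrow> f z | Infty \<Rightarrow> Infty) ^^ n"

definition iter_defined :: "(complex \<Rightarrow> riemann_sphere) \<Rightarrow> nat \<Rightarrow> riemann_sphere \<Rightarrow> bool" where
  "iter_defined f n p \<longleftrightarrow> (\<forall>k<n. iter f k p \<noteq> Infty)"

subsection \<open>Fatou and Julia sets, wandering domains\<close>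

definition normal_family_on ::
    "riemann_sphere set \<Rightarrow> (riemann_sphere \<Rightarrow> riemann_sphere) set \<Rightarrow> bool" where
  "normal_family_on V \<F> \<longleftrightarrow>
     (\<forall>g :: nat \<Rightarrow> riemann_sphere \<Rightarrow> riemann_sphere. range g \<subseteq> \<F> \<longrightarrow>
        (\<exists>r l. strict_mono r \<and>
           (\<forall>K. compact K \<and> K \<subseteq> V \<longrightarrow> uniform_limit K (g \<circ> r) l sequentially)))"

definition Fatou :: "(complex \<Rightarrow> riemann_sphere) \<Rightarrow> riemann_sphere set" where
  "Fatou f = {p. \<exists>V. open V \<and> p \<in> V \<and> (\<forall>n>0. \<forall>q\<in>V. iter_defined f n q) \<and>
                     normal_family_on V {iter f n |n. n > 0}}"

definition Julia :: "(complex \<Rightarrow> riemann_sphere) \<Rightarrow> riemann_sphere set" where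
  "Julia f = - Fatou f"

definition Fatou_component :: "(complex \<Rightarrow> riemann_sphere) \<Rightarrow> riemann_sphere set \<Rightarrow> bool" where
  "Fatou_component f U \<longleftrightarrow> U \<in> components (Fatou f)"

text \<open>For nonconstant meromorphic \<open>f\<close> the Fatou set is forward invariant, so the description
  below determines a unique component.\<close>

definition Fatou_component_image ::
    "(complex \<Rightarrow> riemann_sphere) \<Rightarrow> riemann_sphere set \<Rightarrow> nat \<Rightarrow> riemann_sphere set" where
  "Fatou_component_image f U n = (THE V. Fatou_component f V \<and> iter f n ` U \<subseteq> V)"

definition wandering_domain :: "(complex \<Rightarrow> riemann_sphere) \<Rightarrow> riemann_sphere set \<Rightarrow> bool" where
  "wandering_domain f U \<longleftrightarrow> Fatou_component f U \<and>
     (\<forall>m n. m \<noteq> n \<longrightarrow> Fatou_component_image f U m \<noteq> Fatou_component_image f U n)"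

subsection \<open>Newton's method for \<open>a e\<^sup>z + b z + c\<close>\<close>

lemma deriv_exp_plus_linear:
  fixes a b c :: complex
  shows "deriv (\<lambda>z. a * exp z + b * z + c) z = a * exp z + b"
  by (rule DERIV_imp_deriv) (auto intro!: derivative_eq_intros)

lemma newton_map_exp_plus_linear:
  fixes a b c :: complex
  assumes a: "a \<noteq> 0"
  shows "newton_map (\<lambda>z. a * exp z + b * z + c) =
         sphere_map (\<lambda>z. (z - 1 - c / a * exp (- z)) / (1 + b / a * exp (- z)))"
proof
  fix z0 :: complex
  let ?f = "\<lambda>z. z - (a * exp z + b * z + c) / (a * exp z + b)"
  let ?g = "\<lambda>z. (z - 1 - c / a * exp (- z)) / (1 + b / a * exp (- z))"
  have eq: "?f z = ?g z" if "a * exp z + b \<noteq> 0" for z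
  proof -
    have "?g z = (a * exp z * (z - 1 - c / a * exp (- z))) / (a * exp z * (1 + b / a * exp (- z)))"
      using a by simp
    also have "a * exp z * (z - 1 - c / a * exp (- z)) = a * exp z * (z - 1) - c"
      using a by (simp add: exp_minus field_simps)
    also have "a * exp z * (1 + b / a * exp (- z)) = a * exp z + b"
      using a by (simp add: exp_minus field_simps)
    also have "(a * exp z * (z - 1) - c) / (a * exp z + b) = ?f z"
      using that by (simp add: field_simps)
    finally show ?thesis by simp
  qed
  have "\<forall>\<^sub>F z in at z0. a * exp z + b \<noteq> 0"
  proof (cases "a * exp z0 + b = 0")
    case False
    have "((\<lambda>z. a * exp z + b) \<longlongrightarrow> a * exp z0 + b) (at z0)"
      by (intro tendsto_intros)
    then show ?thesis using False by (rule tendsto_imp_eventually_ne)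
  next
    case True
    have "((\<lambda>z. a * exp z + b) has_field_derivative a * exp z0) (at z0)"
      by (auto intro!: derivative_eq_intros)
    then have "((\<lambda>z. ((a * exp z + b) - (a * exp z0 + b)) / (z - z0)) \<longlongrightarrow> a * exp z0) (at z0)"
      by (simp only: has_field_derivative_iff)
    then have "\<forall>\<^sub>F z in at z0. ((a * exp z + b) - (a * exp z0 + b)) / (z - z0) \<noteq> 0"
      by (rule tendsto_imp_eventually_ne) (use a in simp)
    then show ?thesis by eventually_elim (use True in auto)
  qed
  then have ev: "\<forall>\<^sub>F z in at z0. ?f z = ?g z"
    by eventually_elim (rule eq)
  show "newton_map (\<lambda>z. a * exp z + b * z + c) z0 = sphere_map ?g z0"
    unfolding newton_map_def sphere_map_def deriv_exp_plus_linear
    by (simp only: is_pole_cong[OF ev refl] remove_sings_cong[OF ev refl])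
qed

end

theory Submission
  imports Defs
begin

text \<open>
  With \<open>E z = \<beta> e\<^sup>-\<^sup>z\<close> the map is \<open>F z = u + (z - 1 - u) / (1 + E z)\<close>. Its critical points are superattracting
  fixed points, each at a distance from the Julia set that is bounded below uniformly, so its only other
  finite singular value is \<open>u\<close>.

  Let \<open>z\<^sub>n\<close> be an orbit in a wandering domain. Suppose that infinitely many \<open>z\<^sub>n\<close> have distance less
  than \<open>R\<close> to a point \<open>\<zeta>\<^sub>n\<close> of the Julia set. The segment from \<open>z\<^sub>n\<close> to \<open>\<zeta>\<^sub>n\<close>, extended to a neighbourhood of
  fixed relative size, can be pulled back along \<open>F\<^sup>n\<close> to \<open>z\<^sub>0\<close>: near \<open>\<zeta>\<^sub>n\<close> there are no postsingular points, and
  the components of \<open>z\<^sub>1, \<dots>, z\<^sub>n\<close> contain no singular values if the orbit is started late enough, because \<open>u\<close>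
  lies in at most one component of a wandering orbit. The pullbacks omit the poles of \<open>F\<close>, hence form
  a normal family. A constant limit would put Julia points near \<open>z\<^sub>0\<close>; the image of a non-constant limit is
  an open set on which all iterates are finite, hence in the Fatou set, yet it contains a limit of
  Julia points. So the discs around \<open>z\<^sub>n\<close> in the Fatou set have radii tending to infinity.

  This is incompatible with the shape of \<open>F\<close>. The \<open>z\<^sub>n\<close> stay far from the vertical line of poles. To
  the left of it, and to the right of it while \<open>\<bar>(z\<^sub>n - u) E z\<^sub>n\<bar> \<ge> 1/2\<close>, the image of a disc of radius 15
  around \<open>z\<^sub>n\<close> contains a fixed point, so two consecutive components coincide. In the remaining region \<open>F\<close>
  moves points to the left by at least \<open>1/4\<close>, forever.
\<close>

subsection \<open>The chordal metric\<close>

lemma dist_Fin_Fin_power2: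
  "(dist (Fin z) (Fin w))\<^sup>2 = 4 * (cmod (z - w))\<^sup>2 / ((1 + (cmod z)\<^sup>2) * (1 + (cmod w)\<^sup>2))"
proof -
  define a where "a = 2 / (1 + (cmod z)\<^sup>2)"
  define b where "b = 2 / (1 + (cmod w)\<^sup>2)"
  have a: "a * (1 + (cmod z)\<^sup>2) = 2" and b: "b * (1 + (cmod w)\<^sup>2) = 2"
    using one_plus_cmod_sq_pos[of z] one_plus_cmod_sq_pos[of w]
    by (simp_all only: a_def b_def) (simp_all add: field_simps)
  have "(dist (Fin z) (Fin w))\<^sup>2 = (cmod (of_real a * z - of_real b * w))\<^sup>2 + (a - b)\<^sup>2"
    by (simp add: dist_riemann_sphere_def dist_prod_def dist_norm a_def[symmetric] b_def[symmetric]
        power2_commute)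
  also have "\<dots> = a * (a * (1 + (cmod z)\<^sup>2)) + b * (b * (1 + (cmod w)\<^sup>2))
      - 2 * a * b * (1 + (Re z * Re w + Im z * Im w))"
    unfolding cmod_power2 by (simp add: algebra_simps power2_eq_square)
  \<comment> \<open>Both brackets equal 2, so exchanging them keeps the value and lets
    \<open>a * b\<close> be factored out.\<close>
  also have "\<dots> = a * (b * (1 + (cmod w)\<^sup>2)) + b * (a * (1 + (cmod z)\<^sup>2))
      - 2 * a * b * (1 + (Re z * Re w + Im z * Im w))"
    unfolding a b by simp
  also have "\<dots> = a * b * (cmod (z - w))\<^sup>2"
    unfolding cmod_power2 by (simp add: algebra_simps power2_eq_square)
  finally show ?thesis
    by (simp add: a_def b_def field_simps)
qed

lemma dist_Fin_Infty_power2: "(dist (Fin z) Infty)\<^sup>2 = 4 / (1 + (cmod z)\<^sup>2)"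
proof -
  define a where "a = 2 / (1 + (cmod z)\<^sup>2)"
  have a: "a * (1 + (cmod z)\<^sup>2) = 2"
    using one_plus_cmod_sq_pos[of z] by (simp only: a_def) (simp add: field_simps)
  have "(dist (Fin z) Infty)\<^sup>2 = (cmod (of_real a * z))\<^sup>2 + a\<^sup>2"
    by (simp add: dist_riemann_sphere_def dist_prod_def dist_norm a_def[symmetric])
  also have "\<dots> = a * (a * (1 + (cmod z)\<^sup>2))"
    by (simp add: norm_mult algebra_simps power2_eq_square)
  finally show ?thesis
    unfolding a by (simp add: a_def)
qed

lemma dist_Fin_le: "dist (Fin z) (Fin w) \<le> 2 * dist z w"
proof -
  have "1 * 1 \<le> (1 + (cmod z)\<^sup>2) * (1 + (cmod w)\<^sup>2)"
    by (intro mult_mono) auto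
  then have "(dist (Fin z) (Fin w))\<^sup>2 \<le> 4 * (cmod (z - w))\<^sup>2 / 1"
    unfolding dist_Fin_Fin_power2 by (intro divide_left_mono) auto
  then have "(dist (Fin z) (Fin w))\<^sup>2 \<le> (2 * dist z w)\<^sup>2"
    by (simp add: dist_norm power_mult_distrib)
  then show ?thesis
    by (rule power2_le_imp_le) simp
qed

text \<open>The inverse of the Moebius map sending \<open>w\<close> to \<open>1 / (w - p)\<close>: a
  chart of the sphere without \<open>p\<close>, for functions that omit the value
  \<open>p\<close>.\<close>

definition recip :: "complex \<Rightarrow> complex \<Rightarrow> riemann_sphere" where
  "recip p k = (if k = 0 then Infty else Fin (p + 1 / k))"

lemma dist_recip_power2:
  "(dist (recip p k) (recip p l))\<^sup>2 =
     4 * (cmod (k - l))\<^sup>2 /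
       (((cmod k)\<^sup>2 + (cmod (p * k + 1))\<^sup>2) * ((cmod l)\<^sup>2 + (cmod (p * l + 1))\<^sup>2))"
proof -
  have *: "1 + (cmod (p + 1 / k))\<^sup>2 = ((cmod k)\<^sup>2 + (cmod (p * k + 1))\<^sup>2) / (cmod k)\<^sup>2"
    if "k \<noteq> 0" for k
  proof -
    have "p + 1 / k = (p * k + 1) / k"
      using that by (simp add: field_simps)
    then show ?thesis
      using that by (simp add: norm_divide power_divide field_simps)
  qed
  show ?thesis
  proof (cases "k = 0"; cases "l = 0")
    assume "k = 0" "l \<noteq> 0"
    then show ?thesis
      by (simp add: recip_def dist_commute[of Infty] dist_Fin_Infty_power2 *)
  next
    assume k: "k \<noteq> 0" and l: "l \<noteq> 0"
    have "p + 1 / k - (p + 1 / l) = (l - k) / (k * l)"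
      using k l by (simp add: field_simps)
    then have "(cmod (p + 1 / k - (p + 1 / l)))\<^sup>2 = (cmod (k - l))\<^sup>2 / ((cmod k)\<^sup>2 * (cmod l)\<^sup>2)"
      by (simp add: norm_divide norm_mult power_divide power_mult_distrib norm_minus_commute)
    with k l show ?thesis
      by (simp add: recip_def dist_Fin_Fin_power2 * )
  qed (simp_all add: recip_def dist_Fin_Infty_power2 *)
qed

text \<open>The chart is globally Lipschitz because each factor of the denominator in
  \<open>dist_recip_power2\<close> is at least \<open>1 / (1 + |p|^2)\<close>.\<close>

lemma dist_recip_le: "dist (recip p k) (recip p l) \<le> 2 * (1 + (cmod p)\<^sup>2) * dist k l"
proof -
  define c where "c = 1 + (cmod p)\<^sup>2"
  have c: "c > 0"
    unfolding c_def by (rule one_plus_cmod_sq_pos)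
  have n: "1 / c \<le> (cmod k)\<^sup>2 + (cmod (p * k + 1))\<^sup>2" for k
  proof -
    have "1 = cmod ((p * k + 1) - p * k)" by simp
    also have "\<dots> \<le> cmod (p * k + 1) + cmod p * cmod k"
      by (metis norm_mult norm_triangle_ineq4)
    finally have "1 \<le> (cmod (p * k + 1) + cmod p * cmod k)\<^sup>2"
      by (simp add: one_le_power)
    \<comment> \<open>The added square is the remainder in Lagrange's identity for
      \<open>(|k|, |p * k + 1|)\<close> and \<open>(|p|, 1)\<close>; this is Cauchy-Schwarz.\<close>
    also have "\<dots> \<le> (cmod (p * k + 1) + cmod p * cmod k)\<^sup>2 + (cmod k - cmod p * cmod (p * k + 1))\<^sup>2"
      by simp
    also have "\<dots> = c * ((cmod k)\<^sup>2 + (cmod (p * k + 1))\<^sup>2)"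
      unfolding c_def by (simp add: algebra_simps power2_eq_square)
    finally show ?thesis
      using c by (simp add: field_simps)
  qed
  have "(1 / c) * (1 / c) \<le>
      ((cmod k)\<^sup>2 + (cmod (p * k + 1))\<^sup>2) * ((cmod l)\<^sup>2 + (cmod (p * l + 1))\<^sup>2)"
    using n c by (intro mult_mono) auto
  then have "(dist (recip p k) (recip p l))\<^sup>2 \<le> 4 * (cmod (k - l))\<^sup>2 / ((1 / c) * (1 / c))"
    unfolding dist_recip_power2 using c
    by (intro divide_left_mono mult_pos_pos) (auto intro: less_le_trans[OF _ n])
  also have "\<dots> = (2 * c * dist k l)\<^sup>2"
    by (simp add: dist_norm power2_eq_square)
  finally show ?thesis
    unfolding c_def by (rule power2_le_imp_le) simp
qed

lemma continuous_on_Fin: "continuous_on S Fin"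
proof (rule continuous_onI)
  fix x :: complex and e :: real
  assume "0 < e"
  then show "\<exists>d>0. \<forall>x'\<in>S. dist x' x < d \<longrightarrow> dist (Fin x') (Fin x) \<le> e"
    by (intro exI[of _ "e / 2"]) (auto intro: order_trans[OF dist_Fin_le])
qed

lemma continuous_on_stereo: "continuous_on S stereo"
proof (rule continuous_onI)
  fix x :: riemann_sphere and e :: real
  assume "0 < e"
  then show "\<exists>d>0. \<forall>x'\<in>S. dist x' x < d \<longrightarrow> dist (stereo x') (stereo x) \<le> e"
    by (intro exI[of _ e]) (simp add: dist_riemann_sphere_def)
qed

lemma continuous_on_fin_part: "continuous_on (- {Infty}) fin_part"
proof -
  have eq: "fst (stereo p) / of_real (1 - snd (stereo p)) = fin_part p"
    and nz: "snd (stereo p) \<noteq> 1" if p: "p \<noteq> Infty" for p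
  proof -
    obtain z where z: "p = Fin z"
      using p by (cases p) auto
    have "2 / (1 + (cmod z)\<^sup>2) \<noteq> 0"
      using one_plus_cmod_sq_pos[of z] by (metis divide_eq_0_iff less_irrefl zero_neq_numeral)
    then show "fst (stereo p) / of_real (1 - snd (stereo p)) = fin_part p" "snd (stereo p) \<noteq> 1"
      unfolding z by (simp_all del: of_real_divide)
  qed
  have "continuous_on (- {Infty}) (\<lambda>p. fst (stereo p) / of_real (1 - snd (stereo p)))"
    using nz by (intro continuous_intros continuous_on_stereo) auto
  then show ?thesis
    by (rule continuous_on_eq) (use eq in auto)
qed

lemma open_Fin_image:
  assumes "open S"
  shows "open (Fin ` S)"
proof -
  have "open (- {Infty :: riemann_sphere})"
    by (simp add: open_Compl)
  then have "open (- {Infty} \<inter> fin_part -` S)"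
    using assms continuous_on_fin_part continuous_open_preimage by blast
  moreover have "- {Infty} \<inter> fin_part -` S = Fin ` S"
    by (auto simp: image_iff) (metis riemann_sphere.exhaust_sel)
  ultimately show ?thesis by simp
qed

lemma open_vimage_Fin: "open V \<Longrightarrow> open (Fin -` V)"
  by (rule open_vimage[OF _ continuous_on_Fin])

subsection \<open>Normal families\<close>

text \<open>Schottky's theorem, in the form \<open>GPicard3\<close>, turns the omitted values and
  the bound at \<open>w\<close> into bounds on compact sets, and Montel's theorem applies. The bound
  at \<open>w\<close> excludes infinity as a limit.\<close>

lemma normal_omitting_0_1:
  fixes f :: "nat \<Rightarrow> complex \<Rightarrow> complex"
  assumes S: "open S" "connected S" and w: "w \<in> S"
    and hol: "\<And>n. f n holomorphic_on S"
    and omit: "\<And>n z. z \<in> S \<Longrightarrow> f n z \<noteq> 0 \<and> f n z \<noteq> 1"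
    and le1: "\<And>n. cmod (f n w) \<le> 1"
  obtains g r where "g holomorphic_on S" "strict_mono (r :: nat \<Rightarrow> nat)"
    "\<And>K. compact K \<Longrightarrow> K \<subseteq> S \<Longrightarrow> uniform_limit K (\<lambda>n. f (r n)) g sequentially"
proof -
  have bnd: "\<exists>B. \<forall>h\<in>range f. \<forall>z\<in>K. norm (h z) \<le> B" if K: "compact K" "K \<subseteq> S" for K
  proof (rule GPicard3[OF S w subset_refl _ _ _ K, where X = "range f"])
    fix B assume "\<And>h z. h \<in> range f \<Longrightarrow> z \<in> K \<Longrightarrow> norm (h z) \<le> B"
    then show ?thesis by blast
  qed (use hol omit le1 in auto)
  obtain g and r :: "nat \<Rightarrow> nat" where "g holomorphic_on S" "strict_mono r"
      and "\<And>K. compact K \<Longrightarrow> K \<subseteq> S \<Longrightarrow> uniform_limit K (f \<circ> r) g sequentially"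
    by (rule Montel[OF \<open>open S\<close> _ bnd subset_refl]) (use hol in auto)
  then show ?thesis
    using that by (simp add: o_def)
qed

lemma uniform_limit_Lipschitz_compose:
  fixes g :: "'b::metric_space \<Rightarrow> 'c::metric_space"
  assumes lim: "uniform_limit K f l F" and L: "\<And>x y. dist (g x) (g y) \<le> C * dist x y"
  shows "uniform_limit K (\<lambda>n z. g (f n z)) (\<lambda>z. g (l z)) F"
proof (rule uniform_limitI)
  fix e :: real
  assume e: "0 < e"
  define c where "c = \<bar>C\<bar> + 1"
  have "\<forall>\<^sub>F n in F. \<forall>x\<in>K. dist (f n x) (l x) < e / c"
    using e by (intro uniform_limitD[OF lim]) (simp add: c_def)
  then show "\<forall>\<^sub>F n in F. \<forall>x\<in>K. dist (g (f n x)) (g (l x)) < e"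
  proof eventually_elim
    case (elim n)
    show ?case
    proof
      fix x assume "x \<in> K"
      with elim have "dist (f n x) (l x) < e / c" by blast
      then have "c * dist (f n x) (l x) < e"
        by (simp add: c_def field_simps)
      moreover have "C * dist (f n x) (l x) \<le> c * dist (f n x) (l x)"
        unfolding c_def by (intro mult_right_mono) auto
      ultimately show "dist (g (f n x)) (g (l x)) < e"
        using L[of "f n x" "l x"] by linarith
    qed
  qed
qed

text \<open>Depending on whether infinitely many \<open>h n w\<close> lie within
  \<open>|q - p|\<close> of \<open>p\<close>, the function \<open>(h n - p) / (q - p)\<close> or its
  reciprocal is bounded by 1 at \<open>w\<close> for infinitely many \<open>n\<close>; both omit 0
  and 1. Lipschitz maps carry the limit back to the sphere.\<close>

lemma normal_omitting_two_points:
  fixes h :: "nat \<Rightarrow> complex \<Rightarrow> complex"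
  assumes S: "open S" "connected S" "S \<noteq> {}"
    and hol: "\<And>n. h n holomorphic_on S"
    and omit: "\<And>n z. z \<in> S \<Longrightarrow> h n z \<noteq> p \<and> h n z \<noteq> q" and pq: "p \<noteq> q"
  obtains l r where "strict_mono (r :: nat \<Rightarrow> nat)"
    "\<And>K. compact K \<Longrightarrow> K \<subseteq> S \<Longrightarrow> uniform_limit K (\<lambda>n z. Fin (h (r n) z)) l sequentially"
proof -
  obtain w where w: "w \<in> S" using S by blast
  define T where "T = {n. cmod (h n w - p) \<le> cmod (q - p)}"
  note result = that
  \<comment> \<open>The part common to both cases: \<open>\<phi> n\<close> is the normalised
    function, \<open>M\<close> the set of indices where it is bounded at \<open>w\<close>, and
    \<open>\<Lambda>\<close> recovers \<open>Fin (h n z)\<close> from it.\<close>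
  have *: thesis
    if inf: "infinite M" and hol\<phi>: "\<And>n. \<phi> n holomorphic_on S"
      and om: "\<And>n z. z \<in> S \<Longrightarrow> \<phi> n z \<noteq> 0 \<and> \<phi> n z \<noteq> 1"
      and le: "\<And>n. n \<in> M \<Longrightarrow> cmod (\<phi> n w) \<le> 1"
      and L: "\<And>x y. dist (\<Lambda> x) (\<Lambda> y) \<le> C * dist x y"
      and eq: "\<And>n z. z \<in> S \<Longrightarrow> \<Lambda> (\<phi> n z) = Fin (h n z)"
    for M :: "nat set" and \<phi> and \<Lambda> :: "complex \<Rightarrow> riemann_sphere" and C
  proof -
    have mono: "strict_mono (enumerate M)" and mem: "\<And>n. enumerate M n \<in> M"
      using inf by (auto simp: strict_mono_enumerate enumerate_in_set)
    obtain g r where r: "strict_mono (r :: nat \<Rightarrow> nat)"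
      and lim: "\<And>K. compact K \<Longrightarrow> K \<subseteq> S \<Longrightarrow>
        uniform_limit K (\<lambda>n. \<phi> (enumerate M (r n))) g sequentially"
      by (rule normal_omitting_0_1[OF S(1,2) w, of "\<lambda>n. \<phi> (enumerate M n)"])
         (use hol\<phi> om le mem in auto)
    show thesis
    proof (rule result)
      show "strict_mono (enumerate M \<circ> r)"
        using mono r by (rule strict_mono_o)
      fix K :: "complex set" assume K: "compact K" "K \<subseteq> S"
      have "uniform_limit K (\<lambda>n z. \<Lambda> (\<phi> (enumerate M (r n)) z)) (\<lambda>z. \<Lambda> (g z)) sequentially"
        by (rule uniform_limit_Lipschitz_compose[OF lim[OF K] L])
      then show "uniform_limit K (\<lambda>n z. Fin (h ((enumerate M \<circ> r) n) z)) (\<lambda>z. \<Lambda> (g z)) sequentially"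
        by (rule uniform_limit_cong'[THEN iffD1, rotated -1]) (use eq K in auto)
    qed
  qed
  show thesis
  proof (cases "finite T")
    case False
    show thesis
    proof (rule *[OF False, of "\<lambda>n z. (h n z - p) / (q - p)" "\<lambda>x. Fin (p + (q - p) * x)" "2 * cmod (q - p)"])
      show "dist (Fin (p + (q - p) * x)) (Fin (p + (q - p) * y)) \<le> 2 * cmod (q - p) * dist x y" for x y
        by (rule order_trans[OF dist_Fin_le])
           (simp add: dist_norm right_diff_distrib[symmetric] norm_mult)
    qed (use pq omit hol in \<open>auto intro!: holomorphic_intros simp: T_def norm_divide divide_simps\<close>)
  next
    case True
    then have inf: "infinite (- T)"
      by (metis Compl_eq_Diff_UNIV finite_Diff2 infinite_UNIV_nat)
    show thesis
    proof (rule *[OF inf, of "\<lambda>n z. (q - p) / (h n z - p)" "\<lambda>x. recip p (x / (q - p))"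
          "2 * (1 + (cmod p)\<^sup>2) / cmod (q - p)"])
      show "dist (recip p (x / (q - p))) (recip p (y / (q - p)))
          \<le> 2 * (1 + (cmod p)\<^sup>2) / cmod (q - p) * dist x y" for x y
        by (rule order_trans[OF dist_recip_le])
           (simp add: dist_norm diff_divide_distrib[symmetric] norm_divide)
    qed (use pq omit hol in \<open>auto intro!: holomorphic_intros simp: T_def recip_def norm_divide divide_simps\<close>)
  qed
qed

subsection \<open>The Newton map\<close>

lemma exp_eq_1_small:
  fixes s :: complex
  assumes "exp s = 1" "cmod s < 6"
  shows "s = 0"
proof -
  from assms(1) obtain n :: int where n: "Re s = 0" "Im s = of_int (2 * n) * pi"
    by (auto simp: exp_eq_1)
  show ?thesis
  proof (cases "n = 0")
    case True
    with n show ?thesis by (simp add: complex_eq_iff)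
  next
    case False
    then have "1 \<le> \<bar>real_of_int n\<bar>" by linarith
    then have "2 * pi \<le> 2 * pi * \<bar>real_of_int n\<bar>" using pi_gt_zero by simp
    also have "\<dots> = \<bar>Im s\<bar>" by (simp add: n abs_mult)
    also have "\<dots> \<le> cmod s" by (rule abs_Im_le_cmod)
    finally show ?thesis using assms(2) pi_gt3 by linarith
  qed
qed

lemma exp_quotient_tendsto_1: "((\<lambda>s::complex. s / (1 - exp (- s))) \<longlongrightarrow> 1) (at 0)"
proof -
  have "((\<lambda>s::complex. 1 - exp (- s)) has_field_derivative 1) (at 0)"
    by (auto intro!: derivative_eq_intros)
  then have "((\<lambda>s::complex. (1 - exp (- s)) / s) \<longlongrightarrow> 1) (at 0)"
    by (simp add: has_field_derivative_iff)
  then have "((\<lambda>s::complex. inverse ((1 - exp (- s)) / s)) \<longlongrightarrow> inverse 1) (at 0)"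
    by (intro tendsto_inverse) auto
  then show ?thesis by simp
qed

locale newton_exp =
  fixes \<beta> u :: complex
  assumes \<beta>: "\<beta> \<noteq> 0"
begin

definition E :: "complex \<Rightarrow> complex" where
  "E z = \<beta> * exp (- z)"

definition Poles :: "complex set" where
  "Poles = {z. 1 + E z = 0 \<and> z \<noteq> u + 1}"

text \<open>The singularity of the formula at \<open>u + 1\<close>, present when \<open>\<beta> = - e\<^bsup>u+1\<^esup>\<close>, is removable with
  value \<open>u + 1\<close>. At the genuine poles the value of \<open>F\<close> is junk.\<close>

definition F :: "complex \<Rightarrow> complex" where
  "F z = (if 1 + E z = 0 then u + 1 else u + (z - 1 - u) / (1 + E z))"

text \<open>On this set \<open>F ^^ n\<close> is the true iterate for every \<open>n\<close>, since
  the junk values of \<open>F\<close> at poles are never reached.\<close>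

definition Surviving :: "complex set" where
  "Surviving = {z. \<forall>n. (F ^^ n) z \<notin> Poles}"

lemma E_nz [simp]: "E z \<noteq> 0"
  using \<beta> by (simp add: E_def)

lemma E_add: "E (z + w) = E z * exp (- w)"
  by (simp add: E_def exp_add exp_diff exp_minus divide_inverse)

lemma E_holomorphic [holomorphic_intros]: "E holomorphic_on S"
  unfolding E_def by (intro holomorphic_intros)

lemma E_continuous: "continuous_on S E"
  using E_holomorphic by (rule holomorphic_on_imp_continuous_on)

text \<open>With the denominator cleared, the formula persists at the removable singularity, where
  both sides are 0.\<close>

lemma F_eq: "z \<notin> Poles \<Longrightarrow> (F z - u) * (1 + E z) = z - 1 - u"
  by (auto simp: F_def Poles_def)

text \<open>Distinct zeros of \<open>1 + E\<close> differ by multiples of \<open>2 pi i\<close>,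
  hence by more than 6.\<close>

lemma E_ne_minus_1_near:
  assumes "1 + E p = 0" "z \<noteq> p" "dist z p < 6"
  shows "1 + E z \<noteq> 0"
proof
  assume "1 + E z = 0"
  moreover have "E z = E p * exp (- (z - p))"
    using E_add[of p "z - p"] by simp
  moreover have "E p = - 1" "E z = -1"
    using assms(1) \<open>1 + E z = 0\<close> by (simp_all add: add_eq_0_iff)
  ultimately have "exp (- (z - p)) = 1" by simp
  then have "- (z - p) = 0"
    using assms(3) by (intro exp_eq_1_small) (simp_all add: dist_norm norm_minus_commute)
  with assms(2) show False by simp
qed

lemma open_Compl_Poles: "open (- Poles)"
proof -
  have o: "open {z. 1 + E z \<noteq> 0}"
    by (intro open_Collect_neq continuous_intros E_continuous)
  show ?thesis
  proof (cases "1 + E (u + 1) = 0")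
    case True
    then have "- Poles = {z. 1 + E z \<noteq> 0} \<union> ball (u + 1) 1"
      using E_ne_minus_1_near[OF True] by (fastforce simp: Poles_def dist_commute)
    then show ?thesis using o by auto
  next
    case False
    then have "- Poles = {z. 1 + E z \<noteq> 0}"
      by (auto simp: Poles_def)
    then show ?thesis using o by simp
  qed
qed

lemma F_holomorphic: "F holomorphic_on - Poles"
proof -
  have hol: "F holomorphic_on {z. 1 + E z \<noteq> 0}"
    by (rule holomorphic_transform[of "\<lambda>z. u + (z - 1 - u) / (1 + E z)"])
       (auto simp: F_def intro!: holomorphic_intros)
  have o: "open {z. 1 + E z \<noteq> 0}"
    by (intro open_Collect_neq continuous_intros E_continuous)
  have "- Poles - {u + 1} \<subseteq> {z. 1 + E z \<noteq> 0}"
    by (auto simp: Poles_def)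
  with hol have hol': "F holomorphic_on - Poles - {u + 1}"
    by (rule holomorphic_on_subset)
  have at: "(F \<longlongrightarrow> F (u + 1)) (at (u + 1))"
  proof (cases "1 + E (u + 1) = 0")
    case False
    then have "isCont F (u + 1)"
      using hol o holomorphic_on_imp_continuous_on continuous_on_eq_continuous_at by blast
    then show ?thesis by (simp add: isCont_def)
  next
    case True
    \<comment> \<open>Since \<open>E (u + 1) = - 1\<close>, near \<open>u + 1\<close> the map is
      this function of \<open>z - (u + 1)\<close>.\<close>
    have "((\<lambda>z. u + (z - (u + 1)) / (1 - exp (- (z - (u + 1))))) \<longlongrightarrow> u + 1) (at (u + 1))"
      by (intro tendsto_intros filterlim_compose[OF exp_quotient_tendsto_1])
         (auto simp: filterlim_at eventually_at_filter intro!: tendsto_eq_intros)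
    moreover have "\<forall>\<^sub>F z in at (u + 1).
        u + (z - (u + 1)) / (1 - exp (- (z - (u + 1)))) = F z"
    proof -
      have "\<forall>\<^sub>F z in at (u + 1). z \<noteq> u + 1 \<and> dist z (u + 1) < 6"
        unfolding eventually_at by (intro exI[of _ 6]) auto
      then show ?thesis
      proof eventually_elim
        case (elim z)
        have "E (u + 1) = - 1" using True by (simp add: add_eq_0_iff)
        then have "E z = - exp (- (z - (u + 1)))"
          using E_add[of "u + 1" "z - (u + 1)"] by simp
        then show ?case
          using E_ne_minus_1_near[OF True, of z] elim by (simp add: F_def algebra_simps)
      qed
    qed
    ultimately have "(F \<longlongrightarrow> u + 1) (at (u + 1))"
      by (rule Lim_transform_eventually)
    then show ?thesis using True by (simp add: F_def)
  qed
  show ?thesis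
  proof (rule no_isolated_singularity'[OF _ hol' open_Compl_Poles])
    show "(F \<longlongrightarrow> F z) (at z within - Poles)" if "z \<in> {u + 1}" for z
      using that at by (auto intro: Lim_at_imp_Lim_at_within)
  qed simp
qed

lemma F_continuous: "continuous_on (- Poles) F"
  using F_holomorphic by (rule holomorphic_on_imp_continuous_on)

lemma F_field_derivative: "z \<notin> Poles \<Longrightarrow> (F has_field_derivative deriv F z) (at z)"
  using F_holomorphic open_Compl_Poles by (metis ComplI holomorphic_derivI)

text \<open>Implicit differentiation of \<open>F_eq\<close> covers the removable singularity as
  well.\<close>

lemma deriv_F_eq:
  assumes "z \<notin> Poles"
  shows "deriv F z * (1 + E z) = 1 + (F z - u) * E z"
proof -
  have E': "(E has_field_derivative - E z) (at z)"
    unfolding E_def by (auto intro!: derivative_eq_intros)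
  have "((\<lambda>z. (F z - u) * (1 + E z) - (z - 1 - u)) has_field_derivative
      deriv F z * (1 + E z) + (- E z) * (F z - u) - 1) (at z)"
    by (rule derivative_eq_intros F_field_derivative assms E' refl | simp)+
  moreover have "((\<lambda>z. (F z - u) * (1 + E z) - (z - 1 - u)) has_field_derivative 0) (at z)"
    by (rule has_field_derivative_transform_within_open[of "\<lambda>_. 0", OF _ open_Compl_Poles])
       (use assms F_eq in auto)
  ultimately have "deriv F z * (1 + E z) + (- E z) * (F z - u) - 1 = 0"
    by (rule DERIV_unique)
  then show ?thesis by (simp add: algebra_simps)
qed

text \<open>For \<open>h\<close> as in the theorem,
  \<open>h z = a * exp z * (1 + (z - u) * E z)\<close> and
  \<open>deriv h z = a * exp z * (1 + E z)\<close>, so these are the simple zeros of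
  \<open>h\<close>. A double zero can only be \<open>u + 1\<close>.\<close>

definition Crit :: "complex set" where
  "Crit = {z. 1 + E z \<noteq> 0 \<and> (z - u) * E z = - 1}"

lemma Crit_fixed:
  assumes "p \<in> Crit"
  shows "p \<notin> Poles" "F p = p"
proof -
  show n: "p \<notin> Poles" using assms by (auto simp: Crit_def Poles_def)
  have "(p - u) * (1 + E p) = p - 1 - u"
    using assms by (simp add: Crit_def algebra_simps)
  with F_eq[OF n] have "(F p - u) * (1 + E p) = (p - u) * (1 + E p)" by simp
  then show "F p = p" using assms by (simp add: Crit_def)
qed

text \<open>Where \<open>1 + E z\<close> is not 0, a vanishing derivative means
  \<open>(F z - u) * E z = - 1\<close>, and with \<open>F_eq\<close> this forces
  \<open>F z = z\<close>, so that \<open>z\<close> is in \<open>Crit\<close>.\<close>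

lemma deriv_F_nonzero:
  assumes "z \<notin> Poles" "z \<notin> Crit"
  shows "deriv F z \<noteq> 0"
proof
  assume d: "deriv F z = 0"
  show False
  proof (cases "1 + E z = 0")
    case True
    then have z: "z = u + 1" and E1: "E z = - 1"
      using assms(1) by (auto simp: Poles_def add_eq_0_iff)
    have E': "(E has_field_derivative - E z) (at z)"
      unfolding E_def by (auto intro!: derivative_eq_intros)
    \<comment> \<open>At the removable singularity \<open>deriv_F_eq\<close> reads
      \<open>0 = 0\<close>. Differentiated once more it gives the value 1/2 for the derivative,
      contradicting \<open>d\<close>.\<close>
    obtain D where D: "(deriv F has_field_derivative D) (at z)"
      using holomorphic_deriv[OF F_holomorphic open_Compl_Poles] open_Compl_Poles assms(1)
      by (metis ComplI holomorphic_derivI)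
    have "((\<lambda>z. deriv F z * (1 + E z) - (1 + (F z - u) * E z)) has_field_derivative
        D * (1 + E z) + (- E z) * deriv F z - (deriv F z * E z + (- E z) * (F z - u))) (at z)"
      by (rule derivative_eq_intros F_field_derivative assms E' D refl | simp)+
    moreover have "((\<lambda>z. deriv F z * (1 + E z) - (1 + (F z - u) * E z)) has_field_derivative 0) (at z)"
      by (rule has_field_derivative_transform_within_open[of "\<lambda>_. 0", OF _ open_Compl_Poles])
         (use assms deriv_F_eq in auto)
    ultimately have "D * (1 + E z) + (- E z) * deriv F z - (deriv F z * E z + (- E z) * (F z - u)) = 0"
      by (rule DERIV_unique)
    then show False
      using d True z E1 by (simp add: F_def)
  next
    case False
    from d deriv_F_eq[OF assms(1)] have 1: "(F z - u) * E z = - 1"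
      by (metis add_eq_0_iff mult_zero_left)
    with F_eq[OF assms(1)] have "F z = z" by algebra
    with 1 False assms(2) show False by (simp add: Crit_def)
  qed
qed

end

lemma norm_exp_minus_one_bounds:
  fixes w :: complex
  assumes "cmod w \<le> 1/2"
  shows "cmod (exp w - 1) \<le> 2 * cmod w" "cmod (exp w - 1 - w) \<le> 2 * (cmod w)\<^sup>2"
proof -
  have "exp \<bar>Re w\<bar> \<le> exp (1/2 :: real)"
    using assms abs_Re_le_cmod[of w] by simp
  also have "\<dots> \<le> 2" by (rule exp_half_le2)
  finally have e: "exp \<bar>Re w\<bar> \<le> 2" .
  have "cmod (exp w - (\<Sum>i\<le>0. w ^ i / fact i)) \<le> exp \<bar>Re w\<bar> * cmod w ^ Suc 0 / fact 0"
    by (rule Taylor_exp)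
  also have "\<dots> \<le> 2 * cmod w"
    using e by (simp add: mult_right_mono)
  finally show "cmod (exp w - 1) \<le> 2 * cmod w" by simp
  have "cmod (exp w - (\<Sum>i\<le>1. w ^ i / fact i)) \<le> exp \<bar>Re w\<bar> * cmod w ^ Suc 1 / fact 1"
    by (rule Taylor_exp)
  also have "\<dots> \<le> 2 * (cmod w)\<^sup>2"
    using e by (simp add: mult_right_mono power2_eq_square)
  finally show "cmod (exp w - 1 - w) \<le> 2 * (cmod w)\<^sup>2"
    by (simp add: diff_diff_add)
qed

section \<open>Uniform attraction by the critical fixed points\<close>

context newton_exp
begin

text \<open>The zeros of \<open>(z - u) * E z + 1\<close> are isolated, and \<open>u + 1\<close>
  itself is not in \<open>Crit\<close>. The gap makes the basin radius in
  \<open>Crit_attracting\<close> uniform.\<close>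

lemma Crit_gap: obtains \<eta> where "\<eta> > 0" "\<And>p. p \<in> Crit \<Longrightarrow> \<eta> \<le> cmod (p - u - 1)"
proof -
  define k where "k = (\<lambda>z. (z - u) * E z + 1)"
  have hol: "k holomorphic_on UNIV"
    unfolding k_def by (intro holomorphic_intros)
  have ku: "k u \<noteq> 0" by (simp add: k_def)
  have "\<exists>r>0. \<forall>z. dist z (u + 1) < r \<longrightarrow> z \<noteq> u + 1 \<longrightarrow> k z \<noteq> 0"
  proof (cases "k (u + 1) = 0")
    case True
    obtain r where "0 < r" "\<And>z. z \<in> ball (u + 1) r - {u + 1} \<Longrightarrow> k z \<noteq> 0"
      by (rule isolated_zeros[OF hol _ _ _ True _ ku]) auto
    then show ?thesis
      by (intro exI[of _ r]) (auto simp: dist_commute)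
  next
    case False
    have "isCont k (u + 1)"
      using hol by (meson UNIV_I continuous_on_eq_continuous_at holomorphic_on_imp_continuous_on open_UNIV)
    then have "\<forall>\<^sub>F z in nhds (u + 1). k z \<noteq> 0"
      using False by (auto simp: continuous_at tendsto_at_iff_tendsto_nhds intro: tendsto_imp_eventually_ne)
    then show ?thesis
      by (auto simp: eventually_nhds_metric)
  qed
  then obtain r where r: "r > 0" "\<And>z. dist z (u + 1) < r \<Longrightarrow> z \<noteq> u + 1 \<Longrightarrow> k z \<noteq> 0"
    by blast
  show thesis
  proof (rule that[OF r(1)])
    fix p assume p: "p \<in> Crit"
    then have "k p = 0" by (simp add: Crit_def k_def)
    moreover have "p \<noteq> u + 1" using p by (auto simp: Crit_def)
    ultimately show "r \<le> cmod (p - u - 1)"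
      using r(2)[of p] by (fastforce simp: dist_norm diff_diff_eq)
  qed
qed

text \<open>With \<open>t = p - u\<close> one has
  \<open>F (p + w) - p = t * (exp (- w) - 1 + w) / (t - exp (- w))\<close>. The numerator is
  quadratic in \<open>w\<close>, and \<open>|t| / |t - 1|\<close> is bounded by
  \<open>Crit_gap\<close>, independently of \<open>p\<close>.\<close>

lemma Crit_attracting:
  obtains \<delta> where "\<delta> > 0"
    "\<And>p z. p \<in> Crit \<Longrightarrow> cmod (z - p) < \<delta> \<Longrightarrow> z \<notin> Poles \<and> cmod (F z - p) \<le> cmod (z - p)"
proof -
  obtain \<eta> where \<eta>: "\<eta> > 0" "\<And>p. p \<in> Crit \<Longrightarrow> \<eta> \<le> cmod (p - u - 1)"
    using Crit_gap by blast
  \<comment> \<open>The three bounds serve the estimates for \<open>exp\<close>, a denominator of at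
    least \<open>|t - 1| / 2\<close>, and a contraction factor of at most 1.\<close>
  define \<delta> where "\<delta> = min (1/2) (min (\<eta> / 4) (1 / (4 * (1 + 1 / \<eta>))))"
  have \<delta>: "\<delta> > 0" "\<delta> \<le> 1/2" "\<delta> \<le> \<eta> / 4"
    using \<eta>(1) by (auto simp: \<delta>_def add_pos_pos)
  have "\<delta> \<le> 1 / (4 * (1 + 1 / \<eta>))" by (simp add: \<delta>_def)
  then have \<delta>4: "4 * \<delta> * (1 + 1 / \<eta>) \<le> 1"
    using \<eta>(1) by (simp add: field_simps add_pos_pos)
  show thesis
  proof (rule that[OF \<delta>(1)])
    fix p z assume p: "p \<in> Crit" and z: "cmod (z - p) < \<delta>"
    define t where "t = p - u"
    define w where "w = z - p"
    have w: "cmod w < \<delta>" and zw: "z = p + w" using z by (auto simp: w_def)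
    have tE: "t * E p = - 1" using p by (simp add: Crit_def t_def)
    then have t0: "t \<noteq> 0" by auto
    have Ep: "E p = - 1 / t" using tE t0 by (simp add: field_simps)
    have t1: "\<eta> \<le> cmod (t - 1)" using \<eta>(2)[OF p] by (simp add: t_def)
    have b: "cmod (exp (- w) - 1) \<le> 2 * cmod w" "cmod (exp (- w) - 1 + w) \<le> 2 * (cmod w)\<^sup>2"
      using norm_exp_minus_one_bounds[of "- w"] w \<delta> by simp_all
    have "cmod (t - 1) \<le> cmod (t - exp (- w)) + cmod (exp (- w) - 1)"
      using norm_triangle_ineq[of "t - exp (- w)" "exp (- w) - 1"] by simp
    then have den: "cmod (t - 1) / 2 \<le> cmod (t - exp (- w))"
      using b(1) w \<delta> t1 by simp
    then have den0: "t - exp (- w) \<noteq> 0"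
      using t1 \<eta>(1) by auto
    have Q: "1 + E z = (t - exp (- w)) / t"
      using t0 by (simp add: zw E_add Ep field_simps)
    have nz: "1 + E z \<noteq> 0" using Q den0 t0 by simp
    have "F z - p = (z - 1 - u) / (1 + E z) - t"
      using nz by (simp add: F_def t_def)
    also have "z - 1 - u = t - 1 + w"
      by (simp add: zw t_def)
    also have "(t - 1 + w) / (1 + E z) - t = t * (exp (- w) - 1 + w) / (t - exp (- w))"
      unfolding Q using t0 den0 by (simp add: field_simps)
    finally have Fp: "F z - p = t * (exp (- w) - 1 + w) / (t - exp (- w))" .
    have "cmod t \<le> cmod (t - 1) + 1"
      using norm_triangle_ineq[of "t - 1" 1] by simp
    also have "\<dots> \<le> cmod (t - 1) + cmod (t - 1) / \<eta>"
      using t1 \<eta>(1) by (simp add: field_simps)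
    finally have t: "cmod t \<le> (1 + 1 / \<eta>) * cmod (t - 1)"
      by (simp add: algebra_simps)
    have "cmod (F z - p) = cmod t * cmod (exp (- w) - 1 + w) / cmod (t - exp (- w))"
      by (simp add: Fp norm_mult norm_divide)
    also have "\<dots> \<le> ((1 + 1 / \<eta>) * cmod (t - 1)) * (2 * (cmod w)\<^sup>2) / (cmod (t - 1) / 2)"
      using t b(2) den t1 \<eta>(1) by (intro frac_le mult_mono) auto
    also have "\<dots> = 4 * cmod w * (1 + 1 / \<eta>) * cmod w"
      using t1 \<eta>(1) by (auto simp: power2_eq_square)
    also have "\<dots> \<le> 4 * \<delta> * (1 + 1 / \<eta>) * cmod w"
      using w \<eta>(1) by (intro mult_right_mono mult_left_mono) (auto simp: add_nonneg_nonneg)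
    also have "\<dots> \<le> 1 * cmod w"
      using \<delta>4 by (intro mult_right_mono) auto
    finally show "z \<notin> Poles \<and> cmod (F z - p) \<le> cmod (z - p)"
      using nz by (simp add: Poles_def w_def)
  qed
qed

text \<open>The finite part of the Fatou set: on an open set of surviving points the iterates omit
  all poles and are normal by Montel's theorem. \<open>Fatou_eq\<close> makes this precise.\<close>

definition Fatou_fin :: "complex set" where
  "Fatou_fin = interior Surviving"

lemma Crit_ball_Fatou_fin: obtains \<delta> where "\<delta> > 0" "\<And>p. p \<in> Crit \<Longrightarrow> ball p \<delta> \<subseteq> Fatou_fin"
proof -
  obtain \<delta> where \<delta>: "\<delta> > 0"
    "\<And>p z. p \<in> Crit \<Longrightarrow> cmod (z - p) < \<delta> \<Longrightarrow> z \<notin> Poles \<and> cmod (F z - p) \<le> cmod (z - p)"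
    using Crit_attracting by blast
  have "ball p \<delta> \<subseteq> Surviving" if p: "p \<in> Crit" for p
  proof
    fix z assume z: "z \<in> ball p \<delta>"
    have "cmod ((F ^^ n) z - p) < \<delta>" for n
    proof (induction n)
      case 0
      then show ?case using z by (simp add: dist_norm norm_minus_commute)
    next
      case (Suc n)
      then show ?case using \<delta>(2)[OF p Suc] by simp
    qed
    then show "z \<in> Surviving"
      using \<delta>(2)[OF p] by (auto simp: Surviving_def)
  qed
  then show thesis
    using \<delta>(1) by (intro that[of \<delta>]) (auto simp: Fatou_fin_def interior_maximal)
qed

section \<open>Forward and backward invariance of the finite Fatou set\<close>

lemma Surviving_not_Poles: "z \<in> Surviving \<Longrightarrow> (F ^^ n) z \<notin> Poles"
  by (simp add: Surviving_def)

lemma Surviving_imp_not_Pole: "z \<in> Surviving \<Longrightarrow> z \<notin> Poles"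
  using Surviving_not_Poles[of z 0] by simp

lemma F_Surviving_iff: "z \<notin> Poles \<Longrightarrow> F z \<in> Surviving \<longleftrightarrow> z \<in> Surviving"
proof -
  assume z: "z \<notin> Poles"
  have "(\<forall>n. (F ^^ n) z \<notin> Poles) \<longleftrightarrow> (\<forall>n. (F ^^ Suc n) z \<notin> Poles)"
    using z by (metis funpow_0 not0_implies_Suc)
  then show ?thesis
    by (simp add: Surviving_def funpow_Suc_right del: funpow.simps)
qed

lemma open_Fatou_fin: "open Fatou_fin"
  by (simp add: Fatou_fin_def)

lemma Fatou_fin_subset: "Fatou_fin \<subseteq> Surviving"
  by (simp add: Fatou_fin_def interior_subset)

lemma Fatou_fin_not_Poles: "z \<in> Fatou_fin \<Longrightarrow> z \<notin> Poles"
  using Fatou_fin_subset Surviving_imp_not_Pole by blast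

lemma Fatou_fin_backward:
  assumes "z \<notin> Poles" "F z \<in> Fatou_fin"
  shows "z \<in> Fatou_fin"
proof -
  have "open (- Poles \<inter> F -` Fatou_fin)"
    using F_continuous open_Compl_Poles open_Fatou_fin continuous_open_preimage by blast
  moreover have "- Poles \<inter> F -` Fatou_fin \<subseteq> Surviving"
    using F_Surviving_iff Fatou_fin_subset by auto
  ultimately show ?thesis
    using assms unfolding Fatou_fin_def by (metis ComplI IntI interiorI vimageI)
qed

lemma F_open_map:
  assumes "open V" "V \<subseteq> - Poles"
  shows "open (F ` V)"
proof (rule open_mapping_thm2[OF F_holomorphic open_Compl_Poles assms])
  fix X assume X: "open X" "X \<subseteq> - Poles" "X \<noteq> {}"
  show "\<not> F constant_on X"
  proof
    \<comment> \<open>Then every point of \<open>X\<close> is critical, hence fixed, hence equal to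
      the constant value, and \<open>X\<close> would be a single point.\<close>
    assume "F constant_on X"
    then obtain c where c: "\<And>z. z \<in> X \<Longrightarrow> F z = c" by (auto simp: constant_on_def)
    have eq: "z = c" if z: "z \<in> X" for z
    proof -
      have "(F has_field_derivative 0) (at z)"
        by (rule has_field_derivative_transform_within_open[of "\<lambda>_. c", OF _ X(1) z])
           (auto simp: c)
      then have "deriv F z = 0" by (rule DERIV_imp_deriv)
      then have "z \<in> Crit" using deriv_F_nonzero X(2) z by blast
      then show ?thesis using Crit_fixed c z by metis
    qed
    then have "X = {c}" using X(3) by blast
    then show False using X(1) not_open_singleton[of c] by simp
  qed
qed

lemma Fatou_fin_forward:
  assumes "z \<in> Fatou_fin"
  shows "F z \<in> Fatou_fin"
proof -
  have "open (F ` Fatou_fin)"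
    using F_open_map[OF open_Fatou_fin] Fatou_fin_not_Poles by blast
  moreover have "F ` Fatou_fin \<subseteq> Surviving"
    using F_Surviving_iff Fatou_fin_not_Poles Fatou_fin_subset by blast
  ultimately show ?thesis
    using assms unfolding Fatou_fin_def by (metis imageI interiorI)
qed

lemma Fatou_fin_funpow: "z \<in> Fatou_fin \<Longrightarrow> (F ^^ n) z \<in> Fatou_fin"
  by (induction n) (auto intro: Fatou_fin_forward)

lemma Fatou_fin_funpow_backward:
  "(\<And>k. k < n \<Longrightarrow> (F ^^ k) z \<notin> Poles) \<Longrightarrow> (F ^^ n) z \<in> Fatou_fin \<Longrightarrow> z \<in> Fatou_fin"
proof (induction n)
  case (Suc n)
  have "(F ^^ n) z \<in> Fatou_fin"
    by (rule Fatou_fin_backward) (use Suc.prems(1)[of n] Suc.prems(2) in simp_all)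
  then show ?case
    by (intro Suc.IH Suc.prems(1)) simp_all
qed simp

lemma funpow_holomorphic: "open V \<Longrightarrow> V \<subseteq> Surviving \<Longrightarrow> (F ^^ n) holomorphic_on V"
proof (induction n)
  case (Suc n)
  have "(F \<circ> (F ^^ n)) holomorphic_on V"
    using Suc Surviving_not_Poles
    by (intro holomorphic_on_compose_gen[of "F ^^ n" V F "- Poles"] F_holomorphic) auto
  then show ?case by (simp add: o_def)
qed (auto simp: id_def)

lemma pole_near:
  obtains p where "p \<in> Poles" "Re p = ln (cmod \<beta>)" "\<bar>Im p - y\<bar> \<le> 2 * pi"
proof -
  define q where "q = Ln (- \<beta>)"
  define k where "k = \<lfloor>(y - Im q) / (2 * pi)\<rfloor>"
  define p where "p = (\<lambda>j::int. q + 2 * of_int j * of_real pi * \<i>)"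
  have Ep: "1 + E (p j) = 0" for j
  proof -
    have "exp (p j) = exp q * exp (2 * of_int j * of_real pi * \<i>)"
      by (simp add: p_def exp_add)
    also have "exp (2 * of_int j * of_real pi * \<i>) = 1"
      using exp_integer_2pi[of "of_int j"] by (simp add: mult.assoc)
    also have "exp q = - \<beta>" using \<beta> by (simp add: q_def)
    finally show ?thesis using \<beta> by (simp add: E_def exp_minus)
  qed
  have Re: "Re (p j) = ln (cmod \<beta>)" for j
    using \<beta> by (simp add: p_def q_def)
  have Im: "Im (p j) = Im q + 2 * pi * of_int j" for j
    by (simp add: p_def)
  have k: "of_int k \<le> (y - Im q) / (2 * pi)" "(y - Im q) / (2 * pi) \<le> of_int k + 1"
    unfolding k_def by linarith+
  have kk: "2 * pi * of_int k \<le> y - Im q" "y - Im q \<le> 2 * pi * of_int k + 2 * pi"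
    using k by (simp_all add: field_simps)
  \<comment> \<open>One of two neighbouring zeros of \<open>1 + E\<close> may be the removable point
    \<open>u + 1\<close>, so the pair is kept; hence the bound \<open>2 * pi\<close>.\<close>
  have "p k \<noteq> p (k + 1)" using Im[of k] Im[of "k + 1"] by (auto simp: algebra_simps)
  then have "p k \<in> Poles \<or> p (k + 1) \<in> Poles"
    using Ep by (auto simp: Poles_def)
  then show thesis
  proof
    assume "p k \<in> Poles"
    then show thesis by (rule that) (use Re Im[of k] kk in auto)
  next
    assume "p (k + 1) \<in> Poles"
    then show thesis by (rule that) (use Re Im[of "k + 1"] kk in \<open>auto simp: algebra_simps\<close>)
  qed
qed

lemma two_poles: obtains p q where "p \<in> Poles" "q \<in> Poles" "p \<noteq> q"
proof -
  obtain p where p: "p \<in> Poles" by (rule pole_near)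
  obtain q where q: "q \<in> Poles" "\<bar>Im q - (Im p + 100)\<bar> \<le> 2 * pi" by (rule pole_near)
  have "pi < 4" by (rule pi_less_4)
  then have "p \<noteq> q" using q(2) by auto
  with p q show thesis by (intro that)
qed

end

subsection \<open>The Fatou set and its components\<close>

lemma iter_Suc: "iter f (Suc n) p = (case iter f n p of Fin z \<Rightarrow> f z | Infty \<Rightarrow> Infty)"
  by (simp add: iter_def)

lemma iter_0 [simp]: "iter f 0 p = p"
  by (simp add: iter_def)

context newton_exp
begin

text \<open>Puts infinity in place of the junk values of \<open>F\<close>;
  \<open>sphere_map_eq_N_sphere\<close> identifies the result with the Newton map.\<close>

definition N_sphere :: "complex \<Rightarrow> riemann_sphere" where
  "N_sphere z = (if z \<in> Poles then Infty else Fin (F z))"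

lemma iter_N_sphere: "(\<And>k. k < n \<Longrightarrow> (F ^^ k) z \<notin> Poles) \<Longrightarrow> iter N_sphere n (Fin z) = Fin ((F ^^ n) z)"
  by (induction n) (auto simp: iter_Suc N_sphere_def)

lemma iter_N_sphere_Surviving: "z \<in> Surviving \<Longrightarrow> iter N_sphere n (Fin z) = Fin ((F ^^ n) z)"
  by (rule iter_N_sphere) (rule Surviving_not_Poles)

lemma iter_N_sphere_finite_imp:
  "iter N_sphere n (Fin z) \<noteq> Infty \<Longrightarrow> k < n \<Longrightarrow> (F ^^ k) z \<notin> Poles"
proof (induction n arbitrary: k)
  case (Suc n)
  have "iter N_sphere n (Fin z) \<noteq> Infty"
    using Suc.prems(1) by (auto simp: iter_Suc)
  then have *: "\<And>k. k < n \<Longrightarrow> (F ^^ k) z \<notin> Poles" by (rule Suc.IH)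
  then have "iter N_sphere n (Fin z) = Fin ((F ^^ n) z)" by (rule iter_N_sphere)
  then have "(F ^^ n) z \<notin> Poles"
    using Suc.prems(1) by (auto simp: iter_Suc N_sphere_def[of "(F ^^ n) z"])
  then show ?case
    using * Suc.prems(2) by (cases "k = n") auto
qed simp

lemma Surviving_iff_iter: "z \<in> Surviving \<longleftrightarrow> (\<forall>n. iter N_sphere n (Fin z) \<noteq> Infty)"
proof
  assume "\<forall>n. iter N_sphere n (Fin z) \<noteq> Infty"
  then show "z \<in> Surviving"
    unfolding Surviving_def using iter_N_sphere_finite_imp[of "Suc _" z] by blast
qed (simp add: iter_N_sphere_Surviving)

lemma Surviving_iff_iter_defined: "z \<in> Surviving \<longleftrightarrow> (\<forall>n>0. iter_defined N_sphere n (Fin z))"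
  unfolding Surviving_iff_iter iter_defined_def by blast

text \<open>The orbit of a surviving point meets no pole, so all iterates omit two fixed poles on
  the disc.\<close>

lemma ball_normal:
  assumes "r > 0" "ball z r \<subseteq> Surviving"
  shows "normal_family_on (Fin ` ball z r) {iter N_sphere n |n. n > 0}"
  unfolding normal_family_on_def
proof (intro allI impI)
  fix g :: "nat \<Rightarrow> riemann_sphere \<Rightarrow> riemann_sphere"
  assume "range g \<subseteq> {iter N_sphere n |n. n > 0}"
  then have "\<forall>j. \<exists>n. g j = iter N_sphere n" by blast
  then obtain m where m: "\<And>j. g j = iter N_sphere (m j)" by metis
  obtain p q where pq: "p \<in> Poles" "q \<in> Poles" "p \<noteq> q" by (rule two_poles)
  obtain l s where s: "strict_mono (s :: nat \<Rightarrow> nat)"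
    and lim: "\<And>K. compact K \<Longrightarrow> K \<subseteq> ball z r \<Longrightarrow>
      uniform_limit K (\<lambda>n w. Fin ((F ^^ m (s n)) w)) l sequentially"
  proof (rule normal_omitting_two_points[of "ball z r" "\<lambda>n. F ^^ m n" p q])
    show "\<And>n w. w \<in> ball z r \<Longrightarrow> (F ^^ m n) w \<noteq> p \<and> (F ^^ m n) w \<noteq> q"
      using assms(2) Surviving_not_Poles pq by blast
  qed (use assms pq in \<open>auto intro: funpow_holomorphic\<close>)
  show "\<exists>r' l. strict_mono r' \<and> (\<forall>K. compact K \<and> K \<subseteq> Fin ` ball z r \<longrightarrow>
      uniform_limit K (g \<circ> r') l sequentially)"
  proof (intro exI[of _ s] exI[of _ "l \<circ> fin_part"] conjI allI impI s)
    fix K assume K: "compact K \<and> K \<subseteq> Fin ` ball z r"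
    define K' where "K' = fin_part ` K"
    have "continuous_on K fin_part"
      using K by (intro continuous_on_subset[OF continuous_on_fin_part]) auto
    then have K': "compact K'" "K' \<subseteq> ball z r"
      using K compact_continuous_image by (auto simp: K'_def)
    have KK: "w = Fin (fin_part w)" "fin_part w \<in> K'" "fin_part w \<in> Surviving" if w: "w \<in> K" for w
    proof -
      obtain z' where "w = Fin z'" "z' \<in> ball z r" using w K by blast
      then show "w = Fin (fin_part w)" "fin_part w \<in> Surviving"
        using assms(2) by auto
      show "fin_part w \<in> K'"
        unfolding K'_def using w by (rule imageI)
    qed
    have "uniform_limit K' (\<lambda>n w. Fin ((F ^^ m (s n)) w)) l sequentially"
      by (rule lim[OF K'])
    then have "uniform_limit K (\<lambda>n w. Fin ((F ^^ m (s n)) (fin_part w))) (\<lambda>w. l (fin_part w)) sequentially"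
      by (rule uniform_limit_compose') (use KK in auto)
    then show "uniform_limit K (g \<circ> s) (l \<circ> fin_part) sequentially"
    proof (rule uniform_limit_cong'[THEN iffD1, rotated -1])
      fix n w assume "w \<in> K"
      then show "Fin ((F ^^ m (s n)) (fin_part w)) = (g \<circ> s) n w"
        using KK[of w] iter_N_sphere_Surviving[of "fin_part w"] by (simp add: m)
    qed auto
  qed
qed

lemma Fatou_eq: "Fatou N_sphere = Fin ` Fatou_fin"
proof
  show "Fatou N_sphere \<subseteq> Fin ` Fatou_fin"
  proof
    fix p assume "p \<in> Fatou N_sphere"
    then obtain V where V: "open V" "p \<in> V" "\<forall>n>0. \<forall>q\<in>V. iter_defined N_sphere n q"
      unfolding Fatou_def by blast
    \<comment> \<open>Definedness of the first iterate says that the zeroth, the point itself, is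
      finite; so infinity is a Julia point.\<close>
    then have "iter_defined N_sphere 1 p" by simp
    then obtain z where z: "p = Fin z"
      by (cases p) (auto simp: iter_defined_def)
    have "open (Fin -` V)" using V(1) by (rule open_vimage_Fin)
    moreover have "Fin -` V \<subseteq> Surviving"
      using V(3) by (auto simp: Surviving_iff_iter_defined)
    moreover have "z \<in> Fin -` V" using V(2) z by simp
    ultimately have "z \<in> Fatou_fin" unfolding Fatou_fin_def using interiorI by blast
    then show "p \<in> Fin ` Fatou_fin" using z by blast
  qed
  show "Fin ` Fatou_fin \<subseteq> Fatou N_sphere"
  proof
    fix p assume "p \<in> Fin ` Fatou_fin"
    then obtain z where z: "p = Fin z" "z \<in> Fatou_fin" by blast
    then obtain r where r: "r > 0" "ball z r \<subseteq> Surviving"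
      unfolding Fatou_fin_def using mem_interior by blast
    show "p \<in> Fatou N_sphere"
      unfolding Fatou_def
    proof (intro CollectI exI[of _ "Fin ` ball z r"] conjI)
      show "\<forall>n>0. \<forall>q\<in>Fin ` ball z r. iter_defined N_sphere n q"
        using r(2) Surviving_iff_iter_defined by blast
    qed (use r z in \<open>auto intro: open_Fin_image ball_normal\<close>)
  qed
qed

lemma Julia_eq: "{z. Fin z \<in> Julia N_sphere} = - Fatou_fin"
  by (auto simp: Julia_def Fatou_eq)

lemma Fin_image_connected_iff: "S \<subseteq> Fatou_fin \<Longrightarrow> connected (Fin ` S) \<longleftrightarrow> connected S"
proof
  assume "connected (Fin ` S)"
  moreover have "continuous_on (Fin ` S) fin_part"
    by (rule continuous_on_subset[OF continuous_on_fin_part]) auto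
  ultimately have "connected (fin_part ` Fin ` S)"
    by (rule connected_continuous_image[rotated])
  then show "connected S" by (simp add: image_image)
qed (rule connected_continuous_image[OF continuous_on_Fin])

definition fatou_comp :: "complex \<Rightarrow> complex set" where
  "fatou_comp z = connected_component_set Fatou_fin z"

lemma Fatou_component_iff:
  "Fatou_component N_sphere U \<longleftrightarrow> (\<exists>z\<in>Fatou_fin. U = Fin ` fatou_comp z)"
proof -
  have "connected_component_set (Fin ` Fatou_fin) (Fin z) = Fin ` connected_component_set Fatou_fin z"
    if z: "z \<in> Fatou_fin" for z
  proof
    show "Fin ` connected_component_set Fatou_fin z \<subseteq> connected_component_set (Fin ` Fatou_fin) (Fin z)"
      using z by (intro connected_component_maximal connected_continuous_image continuous_on_Fin)
        (auto dest: connected_component_in)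
    define C where "C = connected_component_set (Fin ` Fatou_fin) (Fin z)"
    have C: "connected C" "C \<subseteq> Fin ` Fatou_fin" "Fin z \<in> C"
      using z by (auto simp: C_def connected_component_subset)
    then obtain S where S: "C = Fin ` S" "S \<subseteq> Fatou_fin" by (meson subset_imageE)
    then have "S \<subseteq> connected_component_set Fatou_fin z"
      using C Fin_image_connected_iff by (intro connected_component_maximal) auto
    then show "C \<subseteq> Fin ` connected_component_set Fatou_fin z" using S by blast
  qed
  then show ?thesis
    by (auto simp: Fatou_component_def components_def Fatou_eq fatou_comp_def)
qed

lemma fatou_comp_self: "z \<in> Fatou_fin \<Longrightarrow> z \<in> fatou_comp z"
  by (simp add: fatou_comp_def)

lemma fatou_comp_subset: "fatou_comp z \<subseteq> Fatou_fin"
  by (simp add: fatou_comp_def connected_component_subset)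

lemma fatou_comp_eq: "w \<in> fatou_comp z \<Longrightarrow> fatou_comp w = fatou_comp z"
  unfolding fatou_comp_def by (metis connected_component_eq)

lemma fatou_comp_maximal: "connected S \<Longrightarrow> S \<subseteq> Fatou_fin \<Longrightarrow> z \<in> S \<Longrightarrow> S \<subseteq> fatou_comp z"
  unfolding fatou_comp_def by (intro connected_component_maximal)

lemma connected_fatou_comp: "connected (fatou_comp z)"
  by (simp add: fatou_comp_def)

lemma fatou_comp_image:
  assumes "z \<in> Fatou_fin"
  shows "(F ^^ n) ` fatou_comp z \<subseteq> fatou_comp ((F ^^ n) z)"
proof (rule fatou_comp_maximal)
  have "continuous_on Fatou_fin (F ^^ n)"
    using funpow_holomorphic[OF open_Fatou_fin Fatou_fin_subset] by (rule holomorphic_on_imp_continuous_on)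
  then show "connected ((F ^^ n) ` fatou_comp z)"
    using fatou_comp_subset connected_fatou_comp by (metis connected_continuous_image continuous_on_subset)
  show "(F ^^ n) ` fatou_comp z \<subseteq> Fatou_fin" using fatou_comp_subset Fatou_fin_funpow by blast
qed (use assms fatou_comp_self in blast)

lemma Fatou_component_image_eq:
  assumes z: "z \<in> Fatou_fin"
  shows "Fatou_component_image N_sphere (Fin ` fatou_comp z) n = Fin ` fatou_comp ((F ^^ n) z)"
proof -
  have im: "iter N_sphere n ` Fin ` fatou_comp z = Fin ` (F ^^ n) ` fatou_comp z"
    using fatou_comp_subset Fatou_fin_subset by (force simp: image_image intro!: image_cong iter_N_sphere_Surviving)
  show ?thesis
    unfolding Fatou_component_image_def
  proof (rule the_equality)
    show "Fatou_component N_sphere (Fin ` fatou_comp ((F ^^ n) z)) \<and> iter N_sphere n ` Fin ` fatou_comp z \<subseteq> Fin ` fatou_comp ((F ^^ n) z)"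
      unfolding im Fatou_component_iff using Fatou_fin_funpow[OF z] fatou_comp_image[OF z] by blast
    fix V assume V: "Fatou_component N_sphere V \<and> iter N_sphere n ` Fin ` fatou_comp z \<subseteq> V"
    then obtain w where w: "V = Fin ` fatou_comp w" by (auto simp: Fatou_component_iff)
    have "Fin ((F ^^ n) z) \<in> V"
      using V im fatou_comp_self[OF z] by blast
    then have "(F ^^ n) z \<in> fatou_comp w" using w by auto
    then show "V = Fin ` fatou_comp ((F ^^ n) z)" using w fatou_comp_eq by simp
  qed
qed

lemma wandering_imp:
  assumes "wandering_domain N_sphere U"
  obtains z where "z \<in> Fatou_fin" "\<And>m n. m \<noteq> n \<Longrightarrow> fatou_comp ((F ^^ m) z) \<noteq> fatou_comp ((F ^^ n) z)"
proof -
  from assms obtain z where z: "z \<in> Fatou_fin" "U = Fin ` fatou_comp z"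
    and ne: "\<And>m n. m \<noteq> n \<Longrightarrow> Fatou_component_image N_sphere U m \<noteq> Fatou_component_image N_sphere U n"
    unfolding wandering_domain_def Fatou_component_iff by blast
  show thesis
  proof (rule that[OF z(1)])
    fix m n :: nat assume "m \<noteq> n"
    then show "fatou_comp ((F ^^ m) z) \<noteq> fatou_comp ((F ^^ n) z)"
      using ne[of m n] unfolding z(2) Fatou_component_image_eq[OF z(1)] by auto
  qed
qed

end

subsection \<open>Local inverse branches\<close>

text \<open>The derivative of \<open>f z - A * z\<close> is at most \<open>|A| / 3\<close>, which
  gives injectivity, and Bloch's lemma gives a disc in the image. The radius depends on
  \<open>s\<close> and \<open>A\<close> alone, hence is uniform over many preimages.\<close>

lemma quantitative_inverse:
  assumes hol: "f holomorphic_on V" and V: "open V" "cball x s \<subseteq> V" and s: "s > 0" and A: "A \<noteq> 0"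
    and d: "\<And>z. z \<in> cball x s \<Longrightarrow> cmod (deriv f z - A) \<le> cmod A / 3"
  obtains g where "g holomorphic_on ball (f x) (s * cmod A / 16)" "g (f x) = x"
    "\<And>w. w \<in> ball (f x) (s * cmod A / 16) \<Longrightarrow> g w \<in> ball x s \<and> f (g w) = w"
proof -
  let ?B = "ball (f x) (s * cmod A / 16)"
  have holc: "f holomorphic_on cball x s"
    using hol V(2) by (rule holomorphic_on_subset)
  have bV: "ball x s \<subseteq> V" using V(2) ball_subset_cball by blast
  have holb: "f holomorphic_on ball x s"
    using hol bV by (rule holomorphic_on_subset)
  have dle: "cmod (deriv f z) \<le> 4/3 * cmod A" if "z \<in> cball x s" for z
    using d[OF that] norm_triangle_sub[of "deriv f z" A] by simp
  have dge: "2/3 * cmod A \<le> cmod (deriv f x)"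
    using d[of x] s norm_triangle_sub[of A "deriv f x"] by (simp add: norm_minus_commute)
  have "ball (f x) ((3 - 2 * sqrt 2) * s * cmod (deriv f x)) \<subseteq> f ` ball x s"
  proof (rule Bloch_lemma[OF holc s])
    fix z assume "z \<in> ball x s"
    then show "cmod (deriv f z) \<le> 2 * cmod (deriv f x)"
      using dle[of z] dge by simp
  qed
  \<comment> \<open>Bloch's factor \<open>3 - 2 * sqrt 2\<close> is at least 1/8, and 1/8 times 2/3
    exceeds 1/16.\<close>
  moreover have "s * cmod A / 16 \<le> (3 - 2 * sqrt 2) * s * cmod (deriv f x)"
  proof -
    have "sqrt 2 \<le> 23/16" by (rule real_le_lsqrt) (simp_all add: power2_eq_square)
    then have "(1/8) * s * (2/3 * cmod A) \<le> (3 - 2 * sqrt 2) * s * cmod (deriv f x)"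
      using s dge by (intro mult_mono) auto
    moreover have "s * cmod A / 16 \<le> (1/8) * s * (2/3 * cmod A)"
      using s by simp
    ultimately show ?thesis by linarith
  qed
  ultimately have sub: "?B \<subseteq> f ` ball x s"
    by (meson order_trans subset_ball)
  have inj: "inj_on f (ball x s)"
  proof (rule inj_onI)
    fix z w assume z: "z \<in> ball x s" and w: "w \<in> ball x s" and eq: "f z = f w"
    have "cmod ((f z - A * z) - (f w - A * w)) \<le> (cmod A / 3) * cmod (z - w)"
    proof (rule field_differentiable_bound[of "ball x s" "\<lambda>z. f z - A * z" "\<lambda>z. deriv f z - A"])
      fix t assume t: "t \<in> ball x s"
      then have "(f has_field_derivative deriv f t) (at t)"
        using hol V(1) bV by (meson holomorphic_derivI subsetD)
      then show "((\<lambda>z. f z - A * z) has_field_derivative deriv f t - A) (at t within ball x s)"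
        by (auto intro!: derivative_eq_intros intro: has_field_derivative_at_within)
    qed (use z w d in auto)
    also have "(f z - A * z) - (f w - A * w) = - (A * (z - w))"
      using eq by (simp add: algebra_simps)
    finally have "cmod A * cmod (z - w) \<le> (cmod A / 3) * cmod (z - w)"
      by (simp add: norm_mult)
    then show "z = w" using A by simp
  qed
  obtain g where g: "g holomorphic_on f ` ball x s" "\<And>z. z \<in> ball x s \<Longrightarrow> g (f z) = z"
    using holomorphic_has_inverse[OF holb open_ball inj] by metis
  show thesis
  proof (rule that)
    show "g holomorphic_on ?B" using g(1) sub by (rule holomorphic_on_subset)
    show "g (f x) = x" using g(2) s by simp
    fix w assume "w \<in> ?B"
    then obtain z where "z \<in> ball x s" "w = f z" using sub by blast
    then show "g w \<in> ball x s \<and> f (g w) = w" using g(2) by simp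
  qed
qed

lemma norm_mult_minus_one_le:
  fixes p q :: complex
  assumes "cmod (p - 1) \<le> a" "cmod (q - 1) \<le> b"
  shows "cmod (p * q - 1) \<le> a + b + a * b"
proof -
  have "p * q - 1 = (p - 1) + (q - 1) + (p - 1) * (q - 1)" by (simp add: algebra_simps)
  then have "cmod (p * q - 1) \<le> cmod (p - 1) + cmod (q - 1) + cmod (p - 1) * cmod (q - 1)"
    by (metis norm_mult norm_triangle_le norm_triangle_ineq add_mono order_refl)
  also have "\<dots> \<le> a + b + a * b"
    using assms by (intro add_mono mult_mono) (auto intro: order_trans[OF norm_ge_zero])
  finally show ?thesis .
qed

context newton_exp
begin

definition near_linear :: "real \<Rightarrow> complex \<Rightarrow> complex \<Rightarrow> bool" where
  "near_linear s A x \<longleftrightarrow> cball x s \<subseteq> - Poles \<and> (\<forall>z\<in>cball x s. cmod (deriv F z - A) \<le> cmod A / 3)"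

text \<open>A preimage \<open>x\<close> of a point near \<open>u + A\<close> with \<open>\<bar>x\<bar>\<close> large lies where \<open>F (x + w)\<close> is close to \<open>u + A e\<^sup>w\<close>.\<close>

lemma near_linear_far:
  assumes A: "A \<noteq> 0" and M: "M \<ge> 100" "M \<ge> 24 * (1 + 2 * cmod A) / cmod A"
    and x: "x \<notin> Poles" and v: "cmod (F x - u - A) \<le> cmod A / 40"
    and X: "cmod (x - 1 - u) \<ge> M" "cmod (x - 1 - u) \<ge> M * (2 * cmod A)"
  shows "near_linear (1/80) A x"
  proof -
  define X where "X = x - 1 - u"
  define q where "q = 1 + E x"
  define v where "v = F x - u"
  have vq: "v * q = X" using F_eq[OF x] by (simp add: X_def q_def v_def)
  have X0: "cmod X \<ge> M" "cmod X \<ge> M * (2 * cmod A)" using X by (simp_all add: X_def)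
  then have Xnz: "X \<noteq> 0" using M by auto
  with vq have nz: "v \<noteq> 0" "q \<noteq> 0" by auto
  have "cmod v \<le> 2 * cmod A"
    using v norm_triangle_sub[of v A] norm_ge_zero[of A] unfolding v_def by linarith
  then have "cmod X \<le> 2 * cmod A * cmod q"
    using vq by (metis mult_right_mono norm_ge_zero norm_mult)
  then have "M * (2 * cmod A) \<le> cmod q * (2 * cmod A)"
    using X0(2) by (metis (no_types) mult.commute order_trans)
  then have qM: "M \<le> cmod q" using A by simp
  have main: "z \<notin> Poles \<and> cmod (deriv F z - A) \<le> cmod A / 3" if z: "z \<in> cball x (1/80)" for z
  proof -
    define w where "w = z - x"
    have w: "cmod w \<le> 1/80" and zw: "z = x + w"
      using z by (simp_all add: w_def dist_norm norm_minus_commute)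
    have e1: "cmod (exp w - 1) \<le> 1/40" and e2: "cmod (exp (- w) - 1) \<le> 1/40"
      using norm_exp_minus_one_bounds(1)[of w] norm_exp_minus_one_bounds(1)[of "- w"] w by simp_all
    \<comment> \<open>The relative errors of numerator and denominator:
      \<open>F (x + w) - u = v * exp w * a / b\<close>, with \<open>a\<close> and \<open>b\<close>
      close to 1 because \<open>X\<close> and \<open>q\<close> are at least \<open>M\<close> in
      modulus.\<close>
    define a where "a = 1 + w / X"
    define b where "b = 1 + (exp w - 1) / q"
    have "cmod (w / X) \<le> (1/80) / 100"
      unfolding norm_divide using w X0(1) M by (intro frac_le) auto
    moreover have "cmod ((exp w - 1) / q) \<le> (1/40) / 100"
      unfolding norm_divide using e1 qM M by (intro frac_le) auto
    ultimately have ab: "cmod (a - 1) \<le> 1/8000" "cmod (b - 1) \<le> 1/4000"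
      by (simp_all add: a_def b_def)
    have b12: "1/2 \<le> cmod b"
      using ab(2) norm_triangle_sub[of 1 b] by (simp add: norm_minus_commute)
    then have b0: "b \<noteq> 0" by auto
    have "q * b = q + (exp w - 1)"
      using nz by (simp add: b_def field_simps)
    then have qb: "q * b = E x + exp w" by (simp add: q_def)
    have "exp (- w) * (q * b) = E x * exp (- w) + exp (- w) * exp w"
      unfolding qb by (simp add: distrib_left mult.commute)
    also have "exp (- w) * exp w = 1"
      by (simp flip: exp_add)
    finally have Q: "1 + E z = exp (- w) * q * b"
      by (simp add: zw E_add mult.assoc)
    have Qnz: "1 + E z \<noteq> 0" using Q nz b0 by simp
    then have zPo: "z \<notin> Poles" by (simp add: Poles_def)
    have "X * a = X + w"
      using Xnz by (simp add: a_def distrib_left)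
    then have "z - 1 - u = X * a"
      by (simp add: X_def zw)
    then have "F z - u = (X * a) / (exp (- w) * q * b)"
      using Qnz by (simp add: F_def flip: Q)
    also have "\<dots> = A * ((v / A * exp w) * (a / b))"
      using nz A b0 vq by (simp add: exp_minus field_simps)
    finally have Fz: "F z - u = A * ((v / A * exp w) * (a / b))" .
    have "v / A - 1 = (F x - u - A) / A" using A by (simp add: v_def field_simps)
    then have "cmod (v / A - 1) = cmod (F x - u - A) / cmod A"
      by (simp only: norm_divide)
    then have "cmod (v / A - 1) \<le> 1/40"
      using v A by (simp add: divide_le_eq)
    then have p: "cmod (v / A * exp w - 1) \<le> 1/40 + 1/40 + (1/40) * (1/40)"
      using e1 by (rule norm_mult_minus_one_le)
    have "a / b - 1 = (a - 1 - (b - 1)) / b" using b0 by (simp add: field_simps)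
    then have "cmod (a / b - 1) \<le> (cmod (a - 1) + cmod (b - 1)) / cmod b"
      by (simp only: norm_divide) (intro divide_right_mono norm_triangle_ineq4 norm_ge_zero)
    also have "\<dots> \<le> (1/100) / (1/2)"
      using ab b12 by (intro frac_le) auto
    finally have r: "cmod (a / b - 1) \<le> 1/50" by simp
    have "cmod ((v / A * exp w) * (a / b) - 1) \<le>
        (1/40 + 1/40 + (1/40) * (1/40)) + 1/50 + (1/40 + 1/40 + (1/40) * (1/40)) * (1/50)"
      by (rule norm_mult_minus_one_le[OF p r])
    then have pr: "cmod ((v / A * exp w) * (a / b) - 1) \<le> 1/6" by simp
    have "F z - u - A = A * ((v / A * exp w) * (a / b) - 1)"
      unfolding Fz by (simp only: right_diff_distrib mult_1_right)
    then have FA: "cmod (F z - u - A) \<le> cmod A / 6"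
      using mult_left_mono[OF pr, of "cmod A"] by (simp only: norm_mult) simp
    then have "cmod (F z - u) \<le> 2 * cmod A"
      using norm_triangle_sub[of "F z - u" A] norm_ge_zero[of A] by linarith
    then have n: "cmod (1 - (F z - u)) \<le> 1 + 2 * cmod A"
      using norm_triangle_ineq4[of 1 "F z - u"] by simp
    have "1/2 \<le> cmod (exp (- w))"
      using e2 norm_triangle_sub[of 1 "exp (- w)"] by (simp add: norm_minus_commute)
    then have "(1/2) * M * (1/2) \<le> cmod (exp (- w)) * cmod q * cmod b"
      using qM b12 M by (intro mult_mono) auto
    then have QM: "M / 4 \<le> cmod (1 + E z)" by (simp add: Q norm_mult)
    \<comment> \<open>By \<open>deriv_F_eq\<close> the derivative differs from
      \<open>F z - u\<close> by a term of order \<open>1 / M\<close>.\<close>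
    have "deriv F z - A = (F z - u - A) + (1 - (F z - u)) / (1 + E z)"
      using deriv_F_eq[OF zPo] Qnz by (simp add: field_simps)
    then have "cmod (deriv F z - A) \<le> cmod (F z - u - A) + cmod (1 - (F z - u)) / cmod (1 + E z)"
      by (metis norm_divide norm_triangle_ineq)
    also have "\<dots> \<le> cmod A / 6 + (1 + 2 * cmod A) / (M / 4)"
      using FA n QM M by (intro add_mono frac_le) auto
    also have "(1 + 2 * cmod A) / (M / 4) \<le> cmod A / 6"
      using M A by (simp add: field_simps)
    finally show ?thesis using zPo by simp
  qed
  then show ?thesis unfolding near_linear_def by blast
qed

lemma near_linear_inverse:
  assumes "near_linear s A x" "s > 0" "A \<noteq> 0"
  obtains g where "g holomorphic_on ball (F x) (s * cmod A / 16)" "g (F x) = x"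
    "\<And>w. w \<in> ball (F x) (s * cmod A / 16) \<Longrightarrow> g w \<notin> Poles \<and> F (g w) = w"
proof -
  obtain g where g: "g holomorphic_on ball (F x) (s * cmod A / 16)" "g (F x) = x"
    "\<And>w. w \<in> ball (F x) (s * cmod A / 16) \<Longrightarrow> g w \<in> ball x s \<and> F (g w) = w"
    using quantitative_inverse[OF F_holomorphic open_Compl_Poles, of x s A] assms
    unfolding near_linear_def by blast
  have "ball x s \<subseteq> - Poles"
    using assms(1) ball_subset_cball unfolding near_linear_def by blast
  then show thesis
    using g(3) by (intro that[OF g(1,2)]) blast
qed

text \<open>The preimages tend to infinity, where \<open>near_linear_far\<close> applies with
  \<open>A = y - u\<close>, or they accumulate at a finite preimage of \<open>y\<close>. The latter
  is not critical, since critical points are fixed and \<open>y\<close> is not in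
  \<open>Crit\<close>, so continuity of the derivative suffices.\<close>

lemma near_linear_frequently:
  assumes y: "y \<notin> Crit" "y \<noteq> u" and x: "\<And>n::nat. x n \<notin> Poles"
    and lim: "(\<lambda>n. F (x n)) \<longlonglongrightarrow> y"
  obtains s A where "s > 0" "A \<noteq> 0" "\<exists>\<^sub>F n in sequentially. near_linear s A (x n)"
proof (cases "filterlim x at_infinity sequentially")
  case True
  define A where "A = y - u"
  have A: "A \<noteq> 0" using y by (simp add: A_def)
  define M where "M = max 100 (24 * (1 + 2 * cmod A) / cmod A)"
  define L where "L = max M (M * (2 * cmod A))"
  have "filterlim (\<lambda>n. x n + (- 1 - u)) at_infinity sequentially"
    using True by (rule tendsto_add_filterlim_at_infinity'[OF _ tendsto_const])
  then have "\<forall>\<^sub>F n in sequentially. L \<le> cmod (x n + (- 1 - u))"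
    by (metis filterlim_at_infinity_imp_norm_at_top filterlim_at_top)
  moreover have "(\<lambda>n. F (x n) - u) \<longlonglongrightarrow> A"
    unfolding A_def by (intro tendsto_intros lim)
  then have "\<forall>\<^sub>F n in sequentially. dist (F (x n) - u) A < cmod A / 40"
    using A by (intro tendstoD) auto
  ultimately have "\<forall>\<^sub>F n in sequentially. near_linear (1/80) A (x n)"
  proof eventually_elim
    case (elim n)
    have "x n + (- 1 - u) = x n - 1 - u" by simp
    with elim(1) have "M \<le> cmod (x n - 1 - u)" "M * (2 * cmod A) \<le> cmod (x n - 1 - u)"
      by (simp_all add: L_def)
    with elim(2) show ?case
      by (intro near_linear_far[OF A _ _ x, of M]) (simp_all add: M_def dist_norm)
  qed
  then show thesis
    by (intro that[of "1/80" A]) (auto simp: A eventually_frequently)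
next
  case False
  then obtain B where B: "\<exists>\<^sub>F n in sequentially. cmod (x n) \<le> B"
  proof -
    from False obtain Z where "\<not> (\<forall>\<^sub>F n in sequentially. Z \<le> cmod (x n))"
      unfolding filterlim_at_infinity_conv_norm_at_top filterlim_at_top by blast
    then have "\<exists>\<^sub>F n in sequentially. cmod (x n) \<le> Z"
      by (auto simp: not_eventually elim: frequently_elim1)
    then show ?thesis by (rule that)
  qed
  define N where "N = {n. cmod (x n) \<le> B}"
  have inf: "infinite N"
    using B unfolding N_def by (simp add: frequently_sequentially infinite_nat_iff_unbounded_le)
  define e where "e = enumerate N"
  have e: "strict_mono e" "\<And>n. e n \<in> N"
    using inf by (auto simp: e_def strict_mono_enumerate enumerate_in_set)
  have "\<forall>n. x (e n) \<in> cball 0 B" using e(2) by (simp add: N_def)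
  then obtain l r where r: "strict_mono (r :: nat \<Rightarrow> nat)" "((\<lambda>n. x (e n)) \<circ> r) \<longlonglongrightarrow> l"
    using compact_cball[of 0 B, unfolded compact_def, rule_format, of "\<lambda>n. x (e n)"] by blast
  have xl: "(\<lambda>n. x (e (r n))) \<longlonglongrightarrow> l" using r(2) by (simp add: o_def)
  have er: "strict_mono (\<lambda>n. e (r n))"
    using strict_mono_o[OF e(1) r(1)] by (simp add: o_def)
  have Fl: "(\<lambda>n. F (x (e (r n)))) \<longlonglongrightarrow> y"
    using LIMSEQ_subseq_LIMSEQ[OF lim er] by (simp add: o_def)
  have El: "(\<lambda>n. E (x (e (r n)))) \<longlonglongrightarrow> E l"
    unfolding E_def by (intro tendsto_intros xl)
  have "(\<lambda>n. (F (x (e (r n))) - u) * (1 + E (x (e (r n))))) \<longlonglongrightarrow> (y - u) * (1 + E l)"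
    by (intro tendsto_intros Fl El)
  moreover have "(\<lambda>n. x (e (r n)) - 1 - u) \<longlonglongrightarrow> l - 1 - u"
    by (intro tendsto_intros xl)
  \<comment> \<open>The limit of the cleared equation shows that \<open>l\<close> is not a pole: a
    zero of \<open>1 + E\<close> would have to be \<open>u + 1\<close>.\<close>
  ultimately have eq: "(y - u) * (1 + E l) = l - 1 - u"
    using F_eq[OF x] by (metis (no_types, lifting) LIMSEQ_unique ext)
  then have l: "l \<notin> Poles" by (auto simp: Poles_def)
  have "isCont F l"
    using F_continuous open_Compl_Poles l by (simp add: continuous_on_eq_continuous_at)
  then have "(\<lambda>n. F (x (e (r n)))) \<longlonglongrightarrow> F l"
    using xl by (rule isCont_tendsto_compose)
  with Fl have Fly: "F l = y" by (metis LIMSEQ_unique)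
  have "l \<notin> Crit" using Crit_fixed Fly y by metis
  define A where "A = deriv F l"
  have A: "A \<noteq> 0" using deriv_F_nonzero[OF l \<open>l \<notin> Crit\<close>] by (simp add: A_def)
  have "isCont (deriv F) l"
    using holomorphic_deriv[OF F_holomorphic open_Compl_Poles] open_Compl_Poles l
    by (metis ComplI continuous_on_eq_continuous_at holomorphic_on_imp_continuous_on)
  then have "\<forall>\<^sub>F z in nhds l. dist (deriv F z) A < cmod A / 3"
    unfolding A_def using A
    by (intro tendstoD) (auto simp: A_def continuous_at tendsto_at_iff_tendsto_nhds)
  moreover have "\<forall>\<^sub>F z in nhds l. z \<in> - Poles"
    using open_Compl_Poles l by (intro eventually_nhds_in_open) auto
  ultimately have "\<forall>\<^sub>F z in nhds l. z \<notin> Poles \<and> dist (deriv F z) A < cmod A / 3"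
    by eventually_elim auto
  then obtain d where d: "d > 0" "\<And>z. dist z l < d \<Longrightarrow> z \<notin> Poles \<and> dist (deriv F z) A < cmod A / 3"
    by (auto simp: eventually_nhds_metric)
  have g: "near_linear (d / 2) A z" if "dist z l < d / 2" for z
    unfolding near_linear_def
  proof (intro conjI subsetI ballI)
    fix t assume "t \<in> cball z (d / 2)"
    then have "dist t l < d" using that dist_triangle[of t l z] by (simp add: dist_commute)
    then show "t \<in> - Poles" "cmod (deriv F t - A) \<le> cmod A / 3"
      using d(2)[of t] by (auto simp: dist_norm)
  qed
  have "\<forall>\<^sub>F n in sequentially. dist (x (e (r n))) l < d / 2"
    using xl d(1) by (intro tendstoD) auto
  then have "\<forall>\<^sub>F n in sequentially. near_linear (d / 2) A (x (e (r n)))"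
    by eventually_elim (rule g)
  then obtain n0 where n0: "\<And>n. n \<ge> n0 \<Longrightarrow> near_linear (d / 2) A (x (e (r n)))"
    by (auto simp: eventually_sequentially)
  have "\<exists>\<^sub>F n in sequentially. near_linear (d / 2) A (x n)"
    unfolding frequently_sequentially
  proof
    fix m
    have "m \<le> e (r (max m n0))"
      using seq_suble[OF er, of "max m n0"] by simp
    then show "\<exists>n\<ge>m. near_linear (d / 2) A (x n)"
      using n0[of "max m n0"] by auto
  qed
  then show thesis
    using d(1) A by (intro that[of "d / 2" A]) auto
qed

section \<open>The covering over the complement of the singular values\<close>

definition Regular :: "complex set" where
  "Regular = - (Crit \<union> {u})"

text \<open>Points of \<open>Crit\<close> are fixed, so they are also the critical values;
  \<open>u\<close> is the asymptotic value. A limit of critical points still solves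
  \<open>(l - u) * E l = - 1\<close>, and \<open>Crit_gap\<close> keeps it away from
  \<open>u + 1\<close>, so \<open>Crit\<close> is closed.\<close>

lemma open_Regular: "open Regular"
proof -
  have "closed Crit"
  proof (rule closed_sequential_limits[THEN iffD2], intro allI impI)
    fix x l assume x: "(\<forall>n. x n \<in> Crit) \<and> x \<longlonglongrightarrow> l"
    obtain \<eta> where \<eta>: "\<eta> > 0" "\<And>p. p \<in> Crit \<Longrightarrow> \<eta> \<le> cmod (p - u - 1)"
      using Crit_gap by blast
    have "(\<lambda>n. (x n - u) * E (x n)) \<longlonglongrightarrow> (l - u) * E l"
      unfolding E_def using x by (intro tendsto_intros) auto
    moreover have "(\<lambda>n. (x n - u) * E (x n)) = (\<lambda>n. - 1)"
      using x by (auto simp: Crit_def)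
    ultimately have l1: "(l - u) * E l = - 1"
      by (simp add: LIMSEQ_const_iff)
    have "(\<lambda>n. cmod (x n - u - 1)) \<longlonglongrightarrow> cmod (l - u - 1)"
      using x by (intro tendsto_intros) auto
    then have "\<eta> \<le> cmod (l - u - 1)"
      by (rule LIMSEQ_le_const) (use x \<eta>(2) in auto)
    then have "l \<noteq> u + 1" using \<eta>(1) by auto
    moreover have "1 + E l \<noteq> 0"
    proof
      assume "1 + E l = 0"
      then have "E l = - 1" by (simp add: add_eq_0_iff)
      with l1 have "l = u + 1" by (simp add: algebra_simps)
      with \<open>l \<noteq> u + 1\<close> show False by simp
    qed
    ultimately show "l \<in> Crit" using l1 by (simp add: Crit_def)
  qed
  then show ?thesis unfolding Regular_def by (simp add: open_Compl)
qed

text \<open>One radius serves all preimages at once: otherwise preimages without a branch over discs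
  shrinking to \<open>y\<close> would contradict \<open>near_linear_frequently\<close>.\<close>

lemma local_branches:
  assumes "y \<in> Regular"
  obtains \<rho> where "\<rho> > 0" "ball y \<rho> \<subseteq> Regular"
    "\<And>x. x \<notin> Poles \<Longrightarrow> F x \<in> ball y \<rho> \<Longrightarrow>
      \<exists>g. g holomorphic_on ball y \<rho> \<and> g (F x) = x \<and> (\<forall>w\<in>ball y \<rho>. g w \<notin> Poles \<and> F (g w) = w)"
proof -
  define br where "br \<rho> x \<longleftrightarrow> (\<exists>g. g holomorphic_on ball y \<rho> \<and> g (F x) = x \<and>
      (\<forall>w\<in>ball y \<rho>. g w \<notin> Poles \<and> F (g w) = w))" for \<rho> x
  have "\<exists>\<rho>>0. \<forall>x. x \<notin> Poles \<longrightarrow> F x \<in> ball y \<rho> \<longrightarrow> br \<rho> x"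
  proof (rule ccontr)
    assume neg: "\<not> ?thesis"
    have "\<exists>x. x \<notin> Poles \<and> F x \<in> ball y (1 / real (Suc n)) \<and> \<not> br (1 / real (Suc n)) x" for n
      using neg[unfolded not_ex, rule_format, of "1 / real (Suc n)"] by auto
    then obtain x where x: "\<And>n. x n \<notin> Poles" "\<And>n. F (x n) \<in> ball y (1 / real (Suc n))"
      "\<And>n. \<not> br (1 / real (Suc n)) (x n)" by metis
    have lim: "(\<lambda>n. F (x n)) \<longlonglongrightarrow> y"
    proof (rule metric_LIMSEQ_I)
      fix r :: real assume "r > 0"
      then obtain n0 where n0: "1 / real (Suc n0) < r" using nat_approx_posE by blast
      have "dist (F (x n)) y < r" if "n \<ge> n0" for n
      proof -
        have "1 / real (Suc n) \<le> 1 / real (Suc n0)" using that by (intro frac_le) auto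
        then show ?thesis using x(2)[of n] n0 by (simp add: dist_commute)
      qed
      then show "\<exists>n0. \<forall>n\<ge>n0. dist (F (x n)) y < r" by blast
    qed
    have "y \<notin> Crit" "y \<noteq> u" using assms by (auto simp: Regular_def)
    then obtain s A where s: "s > 0" "A \<noteq> 0" "\<exists>\<^sub>F n in sequentially. near_linear s A (x n)"
      using near_linear_frequently[of y x] x(1) lim by blast
    \<comment> \<open>Half the radius of \<open>near_linear_inverse\<close>, whose disc is centred
      at \<open>F (x n)\<close> and not at \<open>y\<close>.\<close>
    have "s * cmod A / 32 > 0" using s by simp
    then obtain n0 where n0: "1 / real (Suc n0) < s * cmod A / 32" using nat_approx_posE by blast
    obtain n where n: "n \<ge> n0" "near_linear s A (x n)"
      using s(3) unfolding frequently_sequentially by blast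
    obtain g where g: "g holomorphic_on ball (F (x n)) (s * cmod A / 16)" "g (F (x n)) = x n"
      "\<And>w. w \<in> ball (F (x n)) (s * cmod A / 16) \<Longrightarrow> g w \<notin> Poles \<and> F (g w) = w"
      using near_linear_inverse[OF n(2) s(1,2)] by blast
    have "1 / real (Suc n) \<le> 1 / real (Suc n0)" using n(1) by (intro frac_le) auto
    then have lt: "1 / real (Suc n) < s * cmod A / 32" using n0 by linarith
    have "ball y (1 / real (Suc n)) \<subseteq> ball (F (x n)) (s * cmod A / 16)"
    proof
      fix w assume "w \<in> ball y (1 / real (Suc n))"
      with lt x(2)[of n]
      have "dist y w < s * cmod A / 32" "dist y (F (x n)) < s * cmod A / 32"
        unfolding mem_ball by linarith+
      then show "w \<in> ball (F (x n)) (s * cmod A / 16)"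
        using dist_triangle[of "F (x n)" w y] by (simp add: dist_commute)
    qed
    then have "br (1 / real (Suc n)) (x n)"
      unfolding br_def using g by (intro exI[of _ g]) (auto intro: holomorphic_on_subset)
    with x(3) show False by blast
  qed
  then obtain \<rho> where \<rho>: "\<rho> > 0" "\<And>x. x \<notin> Poles \<Longrightarrow> F x \<in> ball y \<rho> \<Longrightarrow> br \<rho> x" by blast
  obtain \<sigma> where \<sigma>: "\<sigma> > 0" "ball y \<sigma> \<subseteq> Regular"
    using open_Regular assms open_contains_ball by blast
  define t where "t = min \<rho> \<sigma>"
  have t: "ball y t \<subseteq> ball y \<rho>" "ball y t \<subseteq> ball y \<sigma>" by (auto simp: t_def)
  show thesis
  proof (rule that[of t])
    show "t > 0" using \<rho> \<sigma> by (simp add: t_def)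
    show "ball y t \<subseteq> Regular" using t \<sigma> by blast
    fix x assume x: "x \<notin> Poles" "F x \<in> ball y t"
    then have "br \<rho> x" using \<rho>(2) t by blast
    then show "\<exists>g. g holomorphic_on ball y t \<and> g (F x) = x \<and> (\<forall>w\<in>ball y t. g w \<notin> Poles \<and> F (g w) = w)"
      unfolding br_def using t(1) by (meson holomorphic_on_subset subsetD)
  qed
qed

definition Regular_pre :: "complex set" where
  "Regular_pre = - Poles \<inter> F -` Regular"

lemma open_Regular_pre: "open Regular_pre"
  unfolding Regular_pre_def using F_continuous open_Compl_Poles open_Regular continuous_open_preimage by blast

lemma Regular_pre_subset: "Regular_pre \<subseteq> - Poles"
  by (simp add: Regular_pre_def)

lemma Crit_countable: "countable Crit"
proof -
  let ?k = "\<lambda>z. (z - u) * E z + 1"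
  have "countable {z \<in> UNIV. ?k z = 0}"
  proof (rule holomorphic_countable_zeros)
    show "?k holomorphic_on UNIV" by (intro holomorphic_intros)
    show "\<not> ?k constant_on UNIV"
    proof
      assume "?k constant_on UNIV"
      then obtain c where "\<And>z. ?k z = c" by (auto simp: constant_on_def)
      then have "?k (u + 1) = ?k u" by metis
      then show False by simp
    qed
  qed auto
  then show ?thesis
    by (rule countable_subset[rotated]) (auto simp: Crit_def)
qed

text \<open>\<open>Regular\<close> is connected as the complement of a countable set. The image is
  open, and it is relatively closed because a branch over a disc that meets the image reaches the
  centre.\<close>

lemma F_surj: "F ` Regular_pre = Regular"
proof -
  have "connected (UNIV - (Crit \<union> {u}))"
    using Crit_countable
    by (intro path_connected_imp_connected path_connected_open_diff_countable) auto
  then have con: "connected Regular" by (simp add: Regular_def Compl_eq_Diff_UNIV)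
  have o1: "open (F ` Regular_pre)" using open_Regular_pre Regular_pre_subset by (rule F_open_map)
  have sub: "F ` Regular_pre \<subseteq> Regular" by (auto simp: Regular_pre_def)
  have o2: "open (Regular - F ` Regular_pre)"
    unfolding open_contains_ball
  proof
    fix y assume y: "y \<in> Regular - F ` Regular_pre"
    then obtain \<rho> where \<rho>: "\<rho> > 0" "ball y \<rho> \<subseteq> Regular"
      "\<And>x. x \<notin> Poles \<Longrightarrow> F x \<in> ball y \<rho> \<Longrightarrow>
        \<exists>g. g holomorphic_on ball y \<rho> \<and> g (F x) = x \<and> (\<forall>w\<in>ball y \<rho>. g w \<notin> Poles \<and> F (g w) = w)"
      using local_branches[of y] by blast
    have "F x \<notin> ball y \<rho>" if x: "x \<in> Regular_pre" for x
    proof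
      assume "F x \<in> ball y \<rho>"
      moreover have "x \<notin> Poles" using x Regular_pre_subset by blast
      ultimately obtain g where "\<forall>w\<in>ball y \<rho>. g w \<notin> Poles \<and> F (g w) = w"
        using \<rho>(3) by blast
      then have "g y \<notin> Poles" "F (g y) = y" using \<rho>(1) by auto
      then have "g y \<in> Regular_pre" "y = F (g y)" using y by (auto simp: Regular_pre_def)
      then have "y \<in> F ` Regular_pre" by (rule image_eqI[rotated])
      with y show False by blast
    qed
    then show "\<exists>e>0. ball y e \<subseteq> Regular - F ` Regular_pre"
      using \<rho>(1,2) by (intro exI[of _ \<rho>]) blast
  qed
  obtain x where "x \<in> Regular_pre"
  proof -
    \<comment> \<open>A nonempty open image cannot lie in the countable set of singular
      values.\<close>
    have "\<not> (- Poles \<subseteq> F -` (Crit \<union> {u}))"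
    proof
      assume "- Poles \<subseteq> F -` (Crit \<union> {u})"
      then have "F ` (- Poles) \<subseteq> Crit \<union> {u}" by auto
      then have "countable (F ` (- Poles))"
        by (rule countable_subset) (simp add: Crit_countable)
      moreover have "open (F ` (- Poles))" using F_open_map[OF open_Compl_Poles] by blast
      moreover have "F ` (- Poles) \<noteq> {}"
      proof -
        have "u + 1 \<in> - Poles" by (simp add: Poles_def)
        then show ?thesis by blast
      qed
      ultimately show False
        by (metis all_not_in_conv countable_subset open_contains_ball uncountable_ball)
    qed
    then show thesis using that by (auto simp: Regular_pre_def Regular_def)
  qed
  then have ne: "F ` Regular_pre \<noteq> {}" by blast
  have "Regular - F ` Regular_pre = {}"
  proof (rule ccontr)
    assume "Regular - F ` Regular_pre \<noteq> {}"
    then have "F ` Regular_pre \<inter> (Regular - F ` Regular_pre) \<inter> Regular \<noteq> {}"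
      using connectedD[OF con o1 o2] ne sub by blast
    then show False by blast
  qed
  then show ?thesis using sub by blast
qed

text \<open>Over a disc from \<open>local_branches\<close> the sheets are the components of the
  preimage; each is the whole image of one branch.\<close>

lemma covering: "covering_space Regular_pre F Regular"
proof
  show "continuous_on Regular_pre F"
    using F_continuous Regular_pre_subset continuous_on_subset by blast
  show "F ` Regular_pre = Regular" by (rule F_surj)
  fix y assume y: "y \<in> Regular"
  obtain \<rho> where \<rho>: "\<rho> > 0" "ball y \<rho> \<subseteq> Regular"
    "\<And>x. x \<notin> Poles \<Longrightarrow> F x \<in> ball y \<rho> \<Longrightarrow>
      \<exists>g. g holomorphic_on ball y \<rho> \<and> g (F x) = x \<and> (\<forall>w\<in>ball y \<rho>. g w \<notin> Poles \<and> F (g w) = w)"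
    using local_branches[OF y] by blast
  define T where "T = ball y \<rho>"
  define P where "P = Regular_pre \<inter> F -` T"
  have P: "P = - Poles \<inter> F -` T" using \<rho>(2) by (auto simp: P_def Regular_pre_def T_def)
  have oP: "open P"
    unfolding P T_def using F_continuous open_Compl_Poles open_ball continuous_open_preimage by blast
  have sheet: "\<exists>q. homeomorphism C T F q" if C: "C \<in> components P" for C
  proof -
    have oC: "open C" using oP C by (rule open_components)
    have cC: "connected C" using C by (rule in_components_connected)
    have CP: "C \<subseteq> P" using C by (rule in_components_subset)
    obtain x where x: "x \<in> C" using C in_components_nonempty by blast
    then have xP: "x \<notin> Poles" "F x \<in> T" using CP P by auto
    then obtain g where g: "g holomorphic_on T" "g (F x) = x"
      "\<And>w. w \<in> T \<Longrightarrow> g w \<notin> Poles" "\<And>w. w \<in> T \<Longrightarrow> F (g w) = w"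
      using \<rho>(3)[of x] unfolding T_def by blast
    have cg: "continuous_on T g" using g(1) by (rule holomorphic_on_imp_continuous_on)
    have gTP: "g ` T \<subseteq> P" using g(3,4) by (auto simp: P)
    have "connected (g ` T)"
      using cg by (rule connected_continuous_image) (simp add: T_def)
    moreover have "x \<in> g ` T" using g(2) xP(2) by (metis imageI)
    ultimately have gTC: "g ` T \<subseteq> C"
      using C gTP x by (intro components_maximal[OF C]) auto
    have inj: "inj_on g T" using g(4) by (metis inj_onI)
    have oT: "open (g ` T)"
      using g(1) _ inj by (rule open_mapping_thm3) (simp add: T_def)
    have contgF: "continuous_on C (\<lambda>z. g (F z))"
    proof (rule continuous_on_compose2[OF cg])
      show "continuous_on C F"
        using F_continuous CP P by (auto intro: continuous_on_subset)
    qed (use CP P in auto)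
    \<comment> \<open>The image of the branch is relatively closed in \<open>C\<close>, being the
      set where \<open>g (F z) = z\<close>.\<close>
    have "open (C \<inter> (\<lambda>z. g (F z) - z) -` (- {0}))"
      using oC by (intro continuous_open_preimage continuous_intros contgF) auto
    moreover have "g (F z) = z \<longleftrightarrow> z \<in> g ` T" if "z \<in> C" for z
    proof
      have "F z \<in> T" using that CP P by auto
      then show "g (F z) = z \<Longrightarrow> z \<in> g ` T" by (metis imageI)
      show "z \<in> g ` T \<Longrightarrow> g (F z) = z" using g(4) by auto
    qed
    then have "C \<inter> (\<lambda>z. g (F z) - z) -` (- {0}) = C - g ` T"
      by auto
    ultimately have o2: "open (C - g ` T)" by simp
    have "C - g ` T = {}"
    proof (rule ccontr)
      assume "C - g ` T \<noteq> {}"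
      then have "g ` T \<inter> (C - g ` T) \<inter> C \<noteq> {}"
        using connectedD[OF cC oT o2] gTC \<open>x \<in> g ` T\<close> by blast
      then show False by blast
    qed
    with gTC have CT: "C = g ` T" by blast
    have "homeomorphism C T F g"
    proof
      show "continuous_on C F"
        using F_continuous CP P by (auto intro: continuous_on_subset)
      show "continuous_on T g" by (rule cg)
    qed (use CT g(4) in auto)
    then show ?thesis by blast
  qed
  show "\<exists>T. y \<in> T \<and> openin (top_of_set Regular) T \<and>
      (\<exists>v. \<Union>v = Regular_pre \<inter> F -` T \<and> (\<forall>u\<in>v. openin (top_of_set Regular_pre) u) \<and>
        pairwise disjnt v \<and> (\<forall>u\<in>v. \<exists>q. homeomorphism u T F q))"
  proof (rule exI[of _ T], intro conjI exI[of _ "components P"] ballI)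
    show "y \<in> T" using \<rho>(1) by (simp add: T_def)
    show "openin (top_of_set Regular) T"
      using \<rho>(2) by (simp add: T_def openin_open_eq open_Regular)
    show "\<Union>(components P) = Regular_pre \<inter> F -` T" by (simp add: P_def)
    show "pairwise disjnt (components P)"
      unfolding pairwise_def disjnt_def using components_nonoverlap by blast
    fix C assume C: "C \<in> components P"
    show "\<exists>q. homeomorphism C T F q" using C by (rule sheet)
    have "C \<subseteq> Regular_pre" using in_components_subset[OF C] by (auto simp: P_def)
    then show "openin (top_of_set Regular_pre) C"
      using open_components[OF oP C] by (simp add: openin_open_eq open_Regular_pre)
  qed
qed

lemma lift_one:
  assumes \<Omega>: "convex \<Omega>" and \<Phi>: "\<Phi> holomorphic_on \<Omega>" "\<Phi> ` \<Omega> \<subseteq> Regular"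
    and s: "s \<in> \<Omega>" and x: "x \<notin> Poles" "F x = \<Phi> s"
  obtains g where "g holomorphic_on \<Omega>" "g s = x"
    "\<And>t. t \<in> \<Omega> \<Longrightarrow> g t \<notin> Poles" "\<And>t. t \<in> \<Omega> \<Longrightarrow> F (g t) = \<Phi> t"
proof -
  have "x \<in> Regular_pre" using x \<Phi>(2) s by (auto simp: Regular_pre_def)
  moreover have c: "continuous_on \<Omega> \<Phi>" using \<Phi>(1) by (rule holomorphic_on_imp_continuous_on)
  moreover have f: "\<Phi> \<in> \<Omega> \<rightarrow> Regular" using \<Phi>(2) by auto
  ultimately obtain g where g: "continuous_on \<Omega> g" "g \<in> \<Omega> \<rightarrow> Regular_pre" "g s = x"
    "\<And>t. t \<in> \<Omega> \<Longrightarrow> F (g t) = \<Phi> t"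
    using covering_space_lift_strong[OF covering _ s convex_imp_simply_connected[OF \<Omega>]
        convex_imp_locally_path_connected[OF \<Omega>], of x \<Phi>] x(2) by metis
  have "g holomorphic_on \<Omega>"
    by (rule covering_space_lift_is_holomorphic[OF covering open_Regular_pre
          holomorphic_on_subset[OF F_holomorphic Regular_pre_subset] \<Phi>(1) f g(2,1,4)])
  then show thesis
    using g Regular_pre_subset by (intro that[of g]) auto
qed

end

subsection \<open>Pulling back discs along the orbit\<close>

context newton_exp
begin

text \<open>Each lift must avoid the singular values before the next one exists. On
  \<open>\<Delta>\<close> it stays in the Fatou component of an orbit point. Elsewhere, meeting
  \<open>u\<close> or \<open>Crit\<close> would push forward to a value of \<open>\<phi>\<close> in
  the orbit of \<open>u\<close> or in \<open>Crit\<close>.\<close>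

lemma lift_iterate:
  assumes \<Omega>: "convex \<Omega>" and \<phi>: "\<phi> holomorphic_on \<Omega>"
    and s: "s \<in> \<Omega>" "\<phi> s = (F ^^ n) x" and x: "x \<in> Fatou_fin"
    and \<Delta>: "connected \<Delta>" "s \<in> \<Delta>" "\<Delta> \<subseteq> \<Omega>" "\<phi> ` \<Delta> \<subseteq> Fatou_fin"
    and P: "\<And>t. t \<in> \<Omega> - \<Delta> \<Longrightarrow> \<phi> t \<notin> Crit \<and> (\<forall>j. \<phi> t \<noteq> (F ^^ j) u)"
    and C: "\<And>m. m \<ge> 1 \<Longrightarrow> fatou_comp ((F ^^ m) x) \<subseteq> Regular"
    and k: "k \<le> n"
  shows "\<exists>g. g holomorphic_on \<Omega> \<and> g s = (F ^^ (n - k)) x \<and>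
    (\<forall>t\<in>\<Omega>. (\<forall>j<k. (F ^^ j) (g t) \<notin> Poles) \<and> (F ^^ k) (g t) = \<phi> t)"
  using k
proof (induction k)
  case 0
  then show ?case using \<phi> s by (intro exI[of _ \<phi>]) auto
next
  case (Suc k)
  then obtain g where g: "g holomorphic_on \<Omega>" "g s = (F ^^ (n - k)) x"
    "\<And>t j. t \<in> \<Omega> \<Longrightarrow> j < k \<Longrightarrow> (F ^^ j) (g t) \<notin> Poles"
    "\<And>t. t \<in> \<Omega> \<Longrightarrow> (F ^^ k) (g t) = \<phi> t"
    by auto
  have gY: "g ` \<Omega> \<subseteq> Regular"
  proof
    fix y assume "y \<in> g ` \<Omega>"
    then obtain t where t: "t \<in> \<Omega>" "y = g t" by blast
    show "y \<in> Regular"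
    proof (cases "t \<in> \<Delta>")
      case True
      have "g ` \<Delta> \<subseteq> Fatou_fin"
      proof
        fix y assume "y \<in> g ` \<Delta>"
        then obtain t where t: "t \<in> \<Delta>" "y = g t" by blast
        then have t\<Omega>: "t \<in> \<Omega>" using \<Delta>(3) by blast
        show "y \<in> Fatou_fin"
          unfolding t(2) by (rule Fatou_fin_funpow_backward[of k]) (use g(3,4)[OF t\<Omega>] \<Delta>(4) t(1) in auto)
      qed
      moreover have "connected (g ` \<Delta>)"
        using g(1) \<Delta>(1,3)
        by (metis connected_continuous_image continuous_on_subset holomorphic_on_imp_continuous_on)
      moreover have "(F ^^ (n - k)) x \<in> g ` \<Delta>" using \<Delta>(2) g(2) by (metis imageI)
      ultimately have "g ` \<Delta> \<subseteq> fatou_comp ((F ^^ (n - k)) x)"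
        by (intro fatou_comp_maximal)
      \<comment> \<open>Here \<open>Suc k \<le> n\<close> makes the exponent \<open>n - k\<close> at
        least 1, as \<open>C\<close> demands.\<close>
      also have "\<dots> \<subseteq> Regular" using Suc.prems by (intro C) simp
      finally show ?thesis using True t(2) by blast
    next
      case False
      then have \<phi>t: "\<phi> t \<notin> Crit" "\<And>j. \<phi> t \<noteq> (F ^^ j) u" using P t(1) by auto
      have "y \<noteq> u" using g(4)[OF t(1)] \<phi>t(2) t(2) by metis
      moreover have "y \<notin> Crit"
      proof
        assume y: "y \<in> Crit"
        have "(F ^^ i) y = y" for i by (induction i) (use Crit_fixed[OF y] in auto)
        then show False using g(4)[OF t(1)] \<phi>t(1) t(2) y by metis
      qed
      ultimately show ?thesis by (simp add: Regular_def)
    qed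
  qed
  have nk: "n - k = Suc (n - Suc k)" using Suc.prems by simp
  have "(F ^^ (n - Suc k)) x \<notin> Poles" using x Fatou_fin_subset Surviving_not_Poles by blast
  moreover have "F ((F ^^ (n - Suc k)) x) = g s" by (simp add: g(2) nk)
  ultimately obtain g' where g': "g' holomorphic_on \<Omega>" "g' s = (F ^^ (n - Suc k)) x"
    "\<And>t. t \<in> \<Omega> \<Longrightarrow> g' t \<notin> Poles" "\<And>t. t \<in> \<Omega> \<Longrightarrow> F (g' t) = g t"
    using lift_one[OF \<Omega> g(1) gY s(1)] by blast
  show ?case
  proof (intro exI conjI ballI allI impI)
    fix t assume t: "t \<in> \<Omega>"
    show "(F ^^ Suc k) (g' t) = \<phi> t"
      using g'(4)[OF t] g(4)[OF t] by (simp add: funpow_Suc_right del: funpow.simps)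
    fix j assume "j < Suc k"
    then show "(F ^^ j) (g' t) \<notin> Poles"
      using g'(3,4)[OF t] g(3)[OF t] by (cases j) (simp_all add: funpow_Suc_right del: funpow.simps)
  qed (use g' in auto)
qed

section \<open>Limits of the pullbacks\<close>

lemma far_pole: obtains q where "q \<in> Poles" "r \<le> cmod (q - p)" "q \<noteq> p"
proof -
  obtain q where q: "q \<in> Poles" "\<bar>Im q - (Im p + \<bar>r\<bar> + 10)\<bar> \<le> 2 * pi" by (rule pole_near)
  have "pi < 4" by (rule pi_less_4)
  then have "\<bar>r\<bar> < \<bar>Im (q - p)\<bar>" using q(2) by auto
  also have "\<dots> \<le> cmod (q - p)" by (rule abs_Im_le_cmod)
  finally show thesis using q(1) by (intro that[of q]) auto
qed

text \<open>A limit \<open>H\<close> sends \<open>s\<close> to a Fatou point and \<open>t\<close> to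
  a Julia point, so it is not constant. By Hurwitz's theorem its open image survives, which makes
  \<open>H t\<close> a Fatou point after all.\<close>

lemma pullbacks_limit:
  assumes \<Omega>: "open \<Omega>" "connected \<Omega>" "s \<in> \<Omega>" "t \<in> \<Omega>"
    and G: "\<And>i::nat. G i holomorphic_on \<Omega>" "\<And>i. G i s = x" and x: "x \<in> Fatou_fin"
    and fin: "\<And>i v j. v \<in> \<Omega> \<Longrightarrow> j \<le> i \<Longrightarrow> (F ^^ j) (G i v) \<notin> Poles"
    and t: "\<And>i. G i t \<notin> Fatou_fin"
  shows False
proof -
  obtain p where p: "p \<in> Poles" by (rule pole_near)
  \<comment> \<open>Far enough from \<open>p\<close> for the normalised functions to have modulus at
    most 1 at \<open>s\<close>, where all \<open>G i\<close> equal \<open>x\<close>.\<close>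
  obtain q where q: "q \<in> Poles" "cmod (x - p) \<le> cmod (q - p)" "q \<noteq> p" by (rule far_pole)
  have omit: "G i v \<noteq> p \<and> G i v \<noteq> q" if "v \<in> \<Omega>" for i v
    using fin[OF that, of 0 i] p q by auto
  obtain h0 r where h0: "h0 holomorphic_on \<Omega>" "strict_mono (r :: nat \<Rightarrow> nat)"
    and lim0: "\<And>K. compact K \<Longrightarrow> K \<subseteq> \<Omega> \<Longrightarrow>
      uniform_limit K (\<lambda>i v. (G (r i) v - p) / (q - p)) h0 sequentially"
  proof (rule normal_omitting_0_1[OF \<Omega>(1,2,3), of "\<lambda>i v. (G i v - p) / (q - p)"])
    show "cmod ((G n s - p) / (q - p)) \<le> 1" for n
      using q G(2) by (simp add: norm_divide)
    show "v \<in> \<Omega> \<Longrightarrow> (G n v - p) / (q - p) \<noteq> 0 \<and> (G n v - p) / (q - p) \<noteq> 1" for n v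
      using omit q(3) by auto
  qed (use G q(3) in \<open>auto intro!: holomorphic_intros\<close>)
  define H where "H = (\<lambda>v. p + (q - p) * h0 v)"
  have H: "H holomorphic_on \<Omega>" unfolding H_def by (intro holomorphic_intros h0)
  have lim: "uniform_limit K (\<lambda>i. G (r i)) H sequentially" if K: "compact K" "K \<subseteq> \<Omega>" for K
  proof -
    have "uniform_limit K (\<lambda>i v. p + (q - p) * ((G (r i) v - p) / (q - p))) (\<lambda>v. p + (q - p) * h0 v) sequentially"
      by (rule uniform_limit_Lipschitz_compose[OF lim0[OF K], of "\<lambda>x. p + (q - p) * x" "cmod (q - p)"])
         (simp add: dist_norm right_diff_distrib[symmetric] norm_mult)
    then show ?thesis
      using q(3) by (simp add: H_def)
  qed
  have pt: "(\<lambda>i. G (r i) v) \<longlonglongrightarrow> H v" if "v \<in> \<Omega>" for v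
    using tendsto_uniform_limitI[OF lim[of "{v}"]] that by auto
  have "closed (- Fatou_fin)" using open_Fatou_fin by (simp add: closed_Compl)
  then have Ht: "H t \<notin> Fatou_fin"
    using closed_sequentially[OF _ _ pt[OF \<Omega>(4)], of "- Fatou_fin"] t by auto
  have "(\<lambda>i. G (r i) s) \<longlonglongrightarrow> x" using G(2) by simp
  with pt[OF \<Omega>(3)] have Hs: "H s = x" by (rule LIMSEQ_unique)
  have nc: "\<not> H constant_on \<Omega>"
  proof
    assume "H constant_on \<Omega>"
    then have "H t = H s" using \<Omega>(3,4) by (auto simp: constant_on_def)
    with Hs x Ht show False by simp
  qed
  have "H ` \<Omega> \<subseteq> Surviving"
  proof
    fix v assume "v \<in> H ` \<Omega>"
    then obtain a where a: "a \<in> \<Omega>" "v = H a" by blast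
    show "v \<in> Surviving"
    proof (rule ccontr)
      assume "v \<notin> Surviving"
      then obtain j where j: "(F ^^ j) v \<in> Poles" by (auto simp: Surviving_def)
      \<comment> \<open>The shift by \<open>j\<close> leaves only pullbacks on which
        \<open>F ^^ j\<close> avoids the poles; these cannot take the value
        \<open>v\<close>.\<close>
      have ne: "G (r (i + j)) b - v \<noteq> 0" if "b \<in> \<Omega>" for i b
      proof -
        have "j \<le> r (i + j)" using seq_suble[OF h0(2), of "i + j"] by simp
        then show ?thesis using fin[OF that, of j "r (i + j)"] j by auto
      qed
      have "H a - v \<noteq> 0"
      proof (rule Hurwitz_no_zeros[OF \<Omega>(1,2), of "\<lambda>i b. G (r (i + j)) b - v" "\<lambda>b. H b - v"])
        show "\<And>n. (\<lambda>b. G (r (n + j)) b - v) holomorphic_on \<Omega>"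
          by (intro holomorphic_intros G)
        show "(\<lambda>b. H b - v) holomorphic_on \<Omega>" by (intro holomorphic_intros H)
        show "\<not> (\<lambda>b. H b - v) constant_on \<Omega>"
          using nc by (auto simp: constant_on_def) (metis diff_add_cancel)
        fix K assume K: "compact K" "K \<subseteq> \<Omega>"
        have "uniform_limit K (\<lambda>i. G (r (i + j))) H sequentially"
          using filterlim_compose[OF lim[OF K] filterlim_add_const_nat_at_top[of j]] by simp
        then show "uniform_limit K (\<lambda>i b. G (r (i + j)) b - v) (\<lambda>b. H b - v) sequentially"
          by (rule uniform_limit_Lipschitz_compose[where g = "\<lambda>x. x - v" and C = 1])
             (simp add: dist_norm)
      qed (use ne a in auto)
      then show False using a(2) by simp
    qed
  qed
  moreover have "open (H ` \<Omega>)"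
    using open_mapping_thm[OF H \<Omega>(1,2,1) order_refl nc] .
  moreover have "H t \<in> H ` \<Omega>" using \<Omega>(4) by blast
  ultimately have "H t \<in> Fatou_fin" unfolding Fatou_fin_def using interiorI by blast
  with Ht show False by simp
qed

lemma distance_to_boundary_tends_to_infinity:
  assumes x: "x \<in> Fatou_fin" and C: "\<And>m. m \<ge> 1 \<Longrightarrow> fatou_comp ((F ^^ m) x) \<subseteq> Regular"
    and \<delta>: "\<delta> > 0" "\<And>p. p \<in> Crit \<Longrightarrow> ball p \<delta> \<subseteq> Fatou_fin" "\<And>n. ball ((F ^^ n) u) \<delta> \<subseteq> Fatou_fin"
    and R: "R > 0"
  shows "\<forall>\<^sub>F n in sequentially. ball ((F ^^ n) x) R \<subseteq> Fatou_fin"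
proof (rule ccontr)
  assume "\<not> ?thesis"
  then have fr: "\<exists>\<^sub>F n in sequentially. \<not> ball ((F ^^ n) x) R \<subseteq> Fatou_fin"
    by (simp add: not_eventually)
  define \<epsilon> where "\<epsilon> = \<delta> / (2 * R)"
  have \<epsilon>: "\<epsilon> > 0" "2 * \<epsilon> * R = \<delta>" using \<delta> R by (simp_all add: \<epsilon>_def)
  \<comment> \<open>A parameter domain common to all pullbacks: a neighbourhood of the unit segment,
    with 0 standing for the orbit point and 1 for the Julia point.\<close>
  define \<Omega> :: "complex set" where "\<Omega> = (\<Union>a\<in>closed_segment 0 1. \<Union>b\<in>ball 0 \<epsilon>. {a + b})"
  have con: "convex \<Omega>" unfolding \<Omega>_def by (intro convex_sums convex_closed_segment convex_ball)
  have op: "open \<Omega>" unfolding \<Omega>_def by (intro open_sums) simp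
  have mem: "a \<in> \<Omega>" if "a \<in> closed_segment 0 1" for a
    unfolding \<Omega>_def using \<epsilon>(1) by (intro UN_I[OF that] UN_I[of 0]) auto
  have 01: "0 \<in> \<Omega>" "1 \<in> \<Omega>" by (auto intro: mem)
  \<comment> \<open>The part of \<open>\<Omega>\<close> outside the unit disc lies near the end 1;
    as \<open>2 * \<epsilon> * R = \<delta>\<close>, its image will be within
    \<open>\<delta>\<close> of the Julia point.\<close>
  have near1: "cmod (t - 1) < 2 * \<epsilon>" if t: "t \<in> \<Omega>" "1 \<le> cmod t" for t
  proof -
    from t(1) obtain a b where ab: "a \<in> closed_segment 0 1" "cmod b < \<epsilon>" "t = a + b"
      unfolding \<Omega>_def by auto
    from ab(1) obtain c :: real where c: "0 \<le> c" "c \<le> 1" "a = of_real c"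
      by (auto simp: in_segment scaleR_conv_of_real)
    have "1 \<le> c + cmod b"
      using t(2) norm_triangle_ineq[of a b] c ab(3) by simp
    moreover have "a - 1 = of_real (c - 1)" using c by simp
    then have "cmod (a - 1) = 1 - c" using c(2) by (simp only: norm_of_real)
    moreover have "t - 1 = (a - 1) + b" using ab(3) by simp
    then have "cmod (t - 1) \<le> cmod (a - 1) + cmod b" by (metis norm_triangle_ineq)
    ultimately show ?thesis using ab(2) by linarith
  qed
  have clJ: "closed (- Fatou_fin)" using open_Fatou_fin by (simp add: closed_Compl)
  have pull: "\<exists>g. g holomorphic_on \<Omega> \<and> g 0 = x \<and> (\<forall>v\<in>\<Omega>. \<forall>j<n. (F ^^ j) (g v) \<notin> Poles) \<and> g 1 \<notin> Fatou_fin"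
    if n: "\<not> ball ((F ^^ n) x) R \<subseteq> Fatou_fin" for n
  proof -
    define z where "z = (F ^^ n) x"
    have zFK: "z \<in> Fatou_fin" unfolding z_def using x by (rule Fatou_fin_funpow)
    from n obtain a where a: "a \<in> ball z R" "a \<in> - Fatou_fin" unfolding z_def by blast
    \<comment> \<open>A nearest Julia point, so that the open disc about \<open>z\<close> reaching
      up to it is in the Fatou set.\<close>
    obtain \<zeta> where \<zeta>: "\<zeta> \<in> - Fatou_fin" "infdist z (- Fatou_fin) = dist z \<zeta>"
      using infdist_attains_inf[OF clJ] a(2) by blast
    have dR: "dist z \<zeta> < R"
      using infdist_le[OF a(2), of z] a(1) \<zeta>(2) by simp
    have bFK: "ball z (dist z \<zeta>) \<subseteq> Fatou_fin"
    proof
      fix b assume b: "b \<in> ball z (dist z \<zeta>)"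
      show "b \<in> Fatou_fin"
      proof (rule ccontr)
        assume "b \<notin> Fatou_fin"
        then have "dist z \<zeta> \<le> dist z b" using infdist_le[of b "- Fatou_fin" z] \<zeta>(2) by simp
        with b show False by simp
      qed
    qed
    define \<phi> where "\<phi> t = z + t * (\<zeta> - z)" for t
    have "\<exists>g. g holomorphic_on \<Omega> \<and> g 0 = (F ^^ (n - n)) x \<and>
      (\<forall>t\<in>\<Omega>. (\<forall>j<n. (F ^^ j) (g t) \<notin> Poles) \<and> (F ^^ n) (g t) = \<phi> t)"
    \<comment> \<open>\<open>\<Delta>\<close> is the part that \<open>\<phi>\<close> maps into the
      Fatou disc about \<open>z\<close>. Beyond it the values are within \<open>\<delta>\<close> of
      \<open>\<zeta>\<close>, too near a Julia point to be in \<open>Crit\<close> or in the orbit of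
      \<open>u\<close>.\<close>
    proof (rule lift_iterate[OF con _ 01(1) _ x, where \<Delta> = "\<Omega> \<inter> ball 0 1"])
      show "\<phi> holomorphic_on \<Omega>" unfolding \<phi>_def by (intro holomorphic_intros)
      show "\<phi> 0 = (F ^^ n) x" by (simp add: \<phi>_def z_def)
      show "connected (\<Omega> \<inter> ball 0 1)" by (intro convex_connected convex_Int con convex_ball)
      show "\<phi> ` (\<Omega> \<inter> ball 0 1) \<subseteq> Fatou_fin"
      proof
        fix b assume "b \<in> \<phi> ` (\<Omega> \<inter> ball 0 1)"
        then obtain t where t: "cmod t < 1" "b = \<phi> t" by auto
        have "\<zeta> \<noteq> z" using zFK \<zeta>(1) by auto
        then have "cmod t * cmod (\<zeta> - z) < 1 * cmod (\<zeta> - z)"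
          using t(1) by (intro mult_strict_right_mono) auto
        then have "b \<in> ball z (dist z \<zeta>)"
          by (simp add: t(2) \<phi>_def dist_norm norm_mult norm_minus_commute)
        then show "b \<in> Fatou_fin" using bFK by blast
      qed
      fix t assume t: "t \<in> \<Omega> - \<Omega> \<inter> ball 0 1"
      have "\<phi> t - \<zeta> = (t - 1) * (\<zeta> - z)" by (simp add: \<phi>_def algebra_simps)
      then have "dist (\<phi> t) \<zeta> = cmod (t - 1) * dist z \<zeta>"
        by (simp add: dist_norm norm_mult norm_minus_commute)
      also have "\<dots> \<le> cmod (t - 1) * R" using dR by (intro mult_left_mono) auto
      also have "\<dots> < 2 * \<epsilon> * R" using near1[of t] t R by (intro mult_strict_right_mono) auto
      finally have "dist (\<phi> t) \<zeta> < \<delta>" using \<epsilon>(2) by simp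
      then have "\<zeta> \<in> ball (\<phi> t) \<delta>" by simp
      then have "\<not> ball (\<phi> t) \<delta> \<subseteq> Fatou_fin" using \<zeta>(1) by blast
      then show "\<phi> t \<notin> Crit \<and> (\<forall>j. \<phi> t \<noteq> (F ^^ j) u)" using \<delta>(2,3) by metis
    qed (use 01 C in auto)
    then obtain g where g: "g holomorphic_on \<Omega>" "g 0 = x"
      "\<And>t j. t \<in> \<Omega> \<Longrightarrow> j < n \<Longrightarrow> (F ^^ j) (g t) \<notin> Poles"
      "\<And>t. t \<in> \<Omega> \<Longrightarrow> (F ^^ n) (g t) = \<phi> t" by auto
    have "(F ^^ n) (g 1) = \<zeta>" using g(4)[OF 01(2)] by (simp add: \<phi>_def)
    then have "g 1 \<notin> Fatou_fin" using Fatou_fin_funpow \<zeta>(1) by auto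
    with g show ?thesis by auto
  qed
  have "\<forall>i. \<exists>g. g holomorphic_on \<Omega> \<and> g 0 = x \<and>
      (\<forall>v\<in>\<Omega>. \<forall>j\<le>i. (F ^^ j) (g v) \<notin> Poles) \<and> g 1 \<notin> Fatou_fin"
  proof
    fix i
    \<comment> \<open>One iterate more than \<open>i\<close>, so that \<open>j \<le> i\<close> gives
      \<open>j < n\<close>.\<close>
    obtain n where n: "n \<ge> Suc i" "\<not> ball ((F ^^ n) x) R \<subseteq> Fatou_fin"
      using fr unfolding frequently_sequentially by blast
    obtain g where g: "g holomorphic_on \<Omega>" "g 0 = x" "g 1 \<notin> Fatou_fin"
      "\<forall>v\<in>\<Omega>. \<forall>j<n. (F ^^ j) (g v) \<notin> Poles"
      using pull[OF n(2)] by blast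
    have "\<forall>v\<in>\<Omega>. \<forall>j\<le>i. (F ^^ j) (g v) \<notin> Poles"
      using g(4) n(1) by auto
    with g(1-3) show "\<exists>g. g holomorphic_on \<Omega> \<and> g 0 = x \<and>
      (\<forall>v\<in>\<Omega>. \<forall>j\<le>i. (F ^^ j) (g v) \<notin> Poles) \<and> g 1 \<notin> Fatou_fin"
      by blast
  qed
  then obtain G where G: "\<And>i. G i holomorphic_on \<Omega>" "\<And>i. G i 0 = x"
    "\<And>i v j. v \<in> \<Omega> \<Longrightarrow> j \<le> i \<Longrightarrow> (F ^^ j) (G i v) \<notin> Poles" "\<And>i. G i 1 \<notin> Fatou_fin"
    by metis
  show False
    using pullbacks_limit[of \<Omega> 0 1 G x, OF op convex_connected[OF con] 01 G(1,2) x] G(3,4) by blast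
qed

end

subsection \<open>Geometry of the Newton map at large scale\<close>

lemma norm_Ln_le_add:
  assumes "c \<noteq> 0"
  shows "cmod (Ln c) \<le> \<bar>ln (cmod c)\<bar> + 4"
proof -
  have "\<bar>Im (Ln c)\<bar> \<le> pi"
    using Im_Ln_le_pi[OF assms] mpi_less_Im_Ln[OF assms] by linarith
  then show ?thesis
    using cmod_le[of "Ln c"] assms pi_less_4 by simp
qed

lemma abs_ln_le_9:
  fixes y :: real
  assumes "1/500 \<le> y" "y \<le> 500"
  shows "\<bar>ln y\<bar> \<le> 9"
proof -
  have "(2::real) \<le> exp 1" using exp_ge_add_one_self[of "1::real"] by simp
  then have "(2::real) ^ 9 \<le> exp 1 ^ 9" by (intro power_mono) auto
  also have "\<dots> = exp 9" by (simp flip: exp_of_nat_mult)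
  finally have e: "(500::real) \<le> exp 9" by simp
  have *: "ln x \<le> 9" if "0 < x" "x \<le> 500" for x :: real
  proof -
    have "ln x \<le> ln (exp 9)" using that e by (subst ln_le_cancel_iff) auto
    then show ?thesis by simp
  qed
  have "ln y \<le> 9" using assms by (intro *) auto
  moreover have "- ln y \<le> 9"
  proof -
    have "1 / y \<le> 500" using assms by (simp add: field_simps)
    then have "ln (1 / y) \<le> 9" using assms by (intro *) auto
    then show ?thesis using assms by (simp add: ln_div)
  qed
  ultimately show ?thesis by linarith
qed

text \<open>On the disc \<open>Ln (1 + w / B)\<close> has modulus at most 1/2, so Brouwer's theorem
  applies. For nonzero \<open>\<kappa>\<close> the fixed point solves
  \<open>exp w = \<kappa> * (1 + w / B)\<close> if \<open>\<sigma> = 1\<close>, and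
  \<open>exp w * (1 + w / B) = \<kappa>\<close> if \<open>\<sigma> = - 1\<close>.\<close>

lemma brouwer_Ln_fixed_point:
  fixes B \<kappa> :: complex and \<sigma> r :: real
  assumes "r > 0" "4 * r \<le> cmod B" "cmod (Ln \<kappa>) + 1/2 \<le> r" "\<bar>\<sigma>\<bar> = 1"
  obtains w where "cmod w \<le> r" "w = Ln \<kappa> + of_real \<sigma> * Ln (1 + w / B)" "1 + w / B \<noteq> 0"
proof -
  have small: "cmod (w / B) \<le> 1/4" if "w \<in> cball 0 r" for w :: complex
  proof -
    have "cmod w \<le> cmod B / 4" using that assms(2) by simp
    moreover have "cmod B > 0" using assms(1,2) by linarith
    ultimately show ?thesis by (simp add: norm_divide divide_le_eq)
  qed
  have npos: "1 + w / B \<notin> \<real>\<^sub>\<le>\<^sub>0" if "w \<in> cball 0 r" for w :: complex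
  proof
    assume "1 + w / B \<in> \<real>\<^sub>\<le>\<^sub>0"
    then have "Re (1 + w / B) \<le> 0" by (simp add: complex_nonpos_Reals_iff)
    moreover have "\<bar>Re (w / B)\<bar> \<le> 1/4" using small[OF that] abs_Re_le_cmod order_trans by blast
    ultimately show False by simp
  qed
  have B0: "B \<noteq> 0" using assms(1,2) by auto
  obtain w where w: "w \<in> cball 0 r" "Ln \<kappa> + of_real \<sigma> * Ln (1 + w / B) = w"
  proof (rule brouwer_ball[OF assms(1), of 0 "\<lambda>w. Ln \<kappa> + of_real \<sigma> * Ln (1 + w / B)"])
    show "continuous_on (cball 0 r) (\<lambda>w. Ln \<kappa> + of_real \<sigma> * Ln (1 + w / B))"
      using npos B0 by (intro continuous_intros continuous_on_Ln') auto
    show "(\<lambda>w. Ln \<kappa> + of_real \<sigma> * Ln (1 + w / B)) \<in> cball 0 r \<rightarrow> cball 0 r"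
    proof
      fix w :: complex assume w: "w \<in> cball 0 r"
      have "cmod (Ln (1 + w / B)) \<le> 2 * cmod (w / B)"
        using small[OF w] by (intro norm_Ln_le) simp
      then have "cmod (Ln (1 + w / B)) \<le> 1/2" using small[OF w] by linarith
      then have "cmod (of_real \<sigma> * Ln (1 + w / B)) \<le> 1/2"
        using assms(4) by (simp add: norm_mult)
      then have "cmod (Ln \<kappa> + of_real \<sigma> * Ln (1 + w / B)) \<le> r"
        using norm_triangle_ineq[of "Ln \<kappa>" "of_real \<sigma> * Ln (1 + w / B)"] assms(3) by linarith
      then show "Ln \<kappa> + of_real \<sigma> * Ln (1 + w / B) \<in> cball 0 r" by simp
    qed
  qed
  show thesis
    by (rule that[of w]) (use w npos[OF w(1)] in auto)
qed

section \<open>Critical fixed points in the image of a disc\<close>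

context newton_exp
begin

lemma norm_E: "cmod (E z) = exp (ln (cmod \<beta>) - Re z)"
  unfolding E_def norm_mult norm_exp_eq_Re using \<beta> by (simp add: exp_diff exp_minus divide_inverse)

lemma one_plus_E_nonzero: "cmod (E z) \<noteq> 1 \<Longrightarrow> 1 + E z \<noteq> 0"
proof
  assume "cmod (E z) \<noteq> 1" "1 + E z = 0"
  then have "E z = - 1" by (simp add: add_eq_0_iff)
  with \<open>cmod (E z) \<noteq> 1\<close> show False by simp
qed

lemma E_small:
  assumes "Re z \<ge> ln (cmod \<beta>) + 20"
  shows "21 * cmod (E z) \<le> 1"
proof -
  have "21 \<le> exp (Re z - ln (cmod \<beta>))"
    using exp_ge_add_one_self[of "Re z - ln (cmod \<beta>)"] assms by linarith
  moreover have "cmod (E z) = inverse (exp (Re z - ln (cmod \<beta>)))"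
    unfolding norm_E by (simp flip: exp_minus)
  moreover have "21 * inverse e \<le> 1" if "21 \<le> e" for e :: real
    using that by (simp add: field_simps)
  ultimately show ?thesis by simp
qed

text \<open>The conclusion is the equation \<open>F z' = p\<close> with denominators cleared.\<close>

lemma solve_target:
  assumes p: "p \<noteq> u" and B: "60 \<le> cmod (z - 1 - p)"
    and \<kappa>: "1/500 \<le> cmod (E z) * cmod (p - u) / cmod (z - 1 - p)"
      "cmod (E z) * cmod (p - u) / cmod (z - 1 - p) \<le> 500"
  obtains z' where "cmod (z' - z) \<le> 15" "E z' * (p - u) = z' - 1 - p"
proof -
  define b where "b = z - 1 - p"
  \<comment> \<open>For \<open>z' = z + w\<close> the equation becomes
    \<open>exp w * (1 + w / b) = k\<close>.\<close>
  define k where "k = E z * (p - u) / b"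
  have b: "60 \<le> cmod b" using B by (simp add: b_def)
  then have b0: "b \<noteq> 0" by auto
  have k0: "k \<noteq> 0" using p b0 by (simp add: k_def)
  have "cmod k = cmod (E z) * cmod (p - u) / cmod (z - 1 - p)"
    by (simp add: k_def b_def norm_mult norm_divide)
  then have "\<bar>ln (cmod k)\<bar> \<le> 9" using \<kappa> by (intro abs_ln_le_9) auto
  then have Lk: "cmod (Ln k) + 1/2 \<le> 15" using norm_Ln_le_add[OF k0] by linarith
  obtain w where w: "cmod w \<le> 15" "w = Ln k + of_real (- 1) * Ln (1 + w / b)" "1 + w / b \<noteq> 0"
    by (rule brouwer_Ln_fixed_point[of 15 b k "- 1"]) (use b Lk in auto)
  have "exp w = exp (Ln k - Ln (1 + w / b))" using w(2) by simp
  also have "\<dots> = k / (1 + w / b)" using k0 w(3) by (simp add: exp_diff)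
  finally have "exp w = k / (1 + w / b)" .
  moreover have "b + w = b * (1 + w / b)" using b0 by (simp add: distrib_left)
  ultimately have "exp w * (b + w) = k * b" using w(3) by simp
  then have ew: "exp w * (b + w) = E z * (p - u)" using b0 by (simp add: k_def)
  have "E (z + w) * (p - u) = exp (- w) * (E z * (p - u))"
    by (simp add: E_add)
  also have "\<dots> = exp (- w) * exp w * (b + w)" by (simp add: mult.assoc flip: ew)
  also have "exp (- w) * exp w = 1" by (simp flip: exp_add)
  finally show thesis
    using w(1) by (intro that[of "z + w"]) (simp_all add: b_def)
qed

text \<open>Critical points solve \<open>(q - u) E q = - 1\<close>, so they lie near the curve where this product has modulus 1.\<close>

lemma Crit_near:
  assumes t: "24 \<le> cmod (y - u)" and c: "1/2 \<le> cmod (E y) * cmod (y - u)" "cmod (E y) * cmod (y - u) \<le> 2"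
  obtains q where "q \<in> Crit" "cmod (q - y) \<le> 6"
proof -
  define b where "b = y - u"
  \<comment> \<open>The point \<open>y + w\<close> solves the critical equation when
    \<open>exp w = k * (1 + w / b)\<close>.\<close>
  define k where "k = - (E y * b)"
  have b: "24 \<le> cmod b" using t by (simp add: b_def)
  then have b0: "b \<noteq> 0" by auto
  have k0: "k \<noteq> 0" using b0 by (simp add: k_def)
  have ck: "1/2 \<le> cmod k" "cmod k \<le> 2" using c by (simp_all add: k_def b_def norm_mult)
  have "ln (cmod k) \<le> cmod k - 1" using k0 by (intro ln_le_minus_one) simp
  moreover have "ln (1 / cmod k) \<le> 1 / cmod k - 1" using k0 by (intro ln_le_minus_one) simp
  moreover have "1 / cmod k \<le> 2" using ck k0 by (simp add: field_simps)
  moreover have "ln (1 / cmod k) = - ln (cmod k)" using k0 by (simp add: ln_div)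
  ultimately have "\<bar>ln (cmod k)\<bar> \<le> 1" using ck by linarith
  then have Lk: "cmod (Ln k) + 1/2 \<le> 6" using norm_Ln_le_add[OF k0] by linarith
  obtain w where w: "cmod w \<le> 6" "w = Ln k + of_real 1 * Ln (1 + w / b)" "1 + w / b \<noteq> 0"
    by (rule brouwer_Ln_fixed_point[of 6 b k 1]) (use b Lk in auto)
  have "exp w = exp (Ln k + Ln (1 + w / b))" using w(2) by simp
  also have "\<dots> = k * (1 + w / b)" using k0 w(3) by (simp add: exp_add)
  also have "\<dots> = - E y * (b + w)" using b0 by (simp add: k_def field_simps)
  finally have ew: "exp w = - E y * (b + w)" .
  have eq: "(y + w - u) * E (y + w) = - 1"
  proof -
    have "y + w - u = b + w" by (simp add: b_def)
    then have "(y + w - u) * E (y + w) = - (exp (- w) * (- E y * (b + w)))"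
      by (simp add: E_add)
    also have "\<dots> = - 1" unfolding ew[symmetric] by (simp flip: exp_add)
    finally show ?thesis .
  qed
  \<comment> \<open>Otherwise the solution is the double zero \<open>u + 1\<close>, which is too far
    from \<open>y\<close>.\<close>
  have "1 + E (y + w) \<noteq> 0"
  proof
    assume "1 + E (y + w) = 0"
    then have "E (y + w) = - 1" by (simp add: add_eq_0_iff)
    with eq have "(y + w - u) * (- 1) = - 1" by metis
    then have "y + w - u = 1" by (simp only: mult_minus1_right neg_equal_iff_equal)
    moreover have "y + w - u = b + w" by (simp add: b_def)
    ultimately have "b + w = 1" by simp
    then have "b = 1 - w" by (simp add: eq_diff_eq)
    then have "cmod b \<le> 1 + cmod w" using norm_triangle_ineq4[of 1 w] by simp
    with b w(1) show False by simp
  qed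
  then have "y + w \<in> Crit" using eq by (simp add: Crit_def)
  then show thesis using w(1) by (intro that[of "y + w"]) simp_all
qed

text \<open>\<open>Crit_near\<close> replaces \<open>y\<close> by a critical point at distance at
  most 6, and \<open>solve_target\<close> is applied to that. The constants 66 and 300 leave room
  for the change to 60 and 500; the distance 15 from the line of poles keeps \<open>z'\<close> off
  it.\<close>

lemma preimage_of_Crit:
  assumes z: "\<bar>Re z - ln (cmod \<beta>)\<bar> > 15"
    and y: "24 \<le> cmod (y - u)" "1/2 \<le> cmod (E y) * cmod (y - u)" "cmod (E y) * cmod (y - u) \<le> 2"
    and zy: "66 \<le> cmod (z - 1 - y)"
    and \<kappa>: "cmod (z - 1 - y) \<le> 300 * (cmod (E z) * cmod (y - u))"
      "cmod (E z) * cmod (y - u) \<le> 300 * cmod (z - 1 - y)"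
  obtains z' where "cmod (z' - z) \<le> 15" "z' \<notin> Poles" "F z' \<in> Crit"
proof -
  obtain q where q: "q \<in> Crit" "cmod (q - y) \<le> 6" using Crit_near[OF y] by blast
  have "y - u = (q - u) - (q - y)" "q - u = (y - u) + (q - y)"
    "z - 1 - y = (z - 1 - q) + (q - y)" "z - 1 - q = (z - 1 - y) - (q - y)"
    by simp_all
  then have "cmod (y - u) \<le> cmod (q - u) + cmod (q - y)" "cmod (q - u) \<le> cmod (y - u) + cmod (q - y)"
    "cmod (z - 1 - y) \<le> cmod (z - 1 - q) + cmod (q - y)" "cmod (z - 1 - q) \<le> cmod (z - 1 - y) + cmod (q - y)"
    by (metis norm_triangle_ineq norm_triangle_ineq4)+
  then have r: "cmod (y - u) \<le> 4/3 * cmod (q - u)" "cmod (q - u) \<le> 5/4 * cmod (y - u)"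
    "cmod (z - 1 - y) \<le> 11/10 * cmod (z - 1 - q)" "cmod (z - 1 - q) \<le> 12/11 * cmod (z - 1 - y)"
    and q60: "60 \<le> cmod (z - 1 - q)"
    using q(2) y(1) zy by linarith+
  have "cmod (E z) * cmod (y - u) \<le> cmod (E z) * (4/3 * cmod (q - u))"
    "cmod (E z) * cmod (q - u) \<le> cmod (E z) * (5/4 * cmod (y - u))"
    using r by (intro mult_left_mono; simp)+
  then have k: "cmod (z - 1 - q) \<le> 500 * (cmod (E z) * cmod (q - u))"
    "cmod (E z) * cmod (q - u) \<le> 500 * cmod (z - 1 - q)"
    using r(3,4) \<kappa> by linarith+
  have "q \<noteq> u" using q(1) by (auto simp: Crit_def)
  moreover have "0 < cmod (z - 1 - q)" using q60 by linarith
  then have "1/500 \<le> cmod (E z) * cmod (q - u) / cmod (z - 1 - q)"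
    "cmod (E z) * cmod (q - u) / cmod (z - 1 - q) \<le> 500"
    using k by (simp_all add: pos_le_divide_eq pos_divide_le_eq)
  ultimately obtain z' where z': "cmod (z' - z) \<le> 15" "E z' * (q - u) = z' - 1 - q"
    using solve_target[of q z] q60 by blast
  have "\<bar>Re z' - Re z\<bar> \<le> 15" using abs_Re_le_cmod[of "z' - z"] z'(1) by simp
  then have "Re z' \<noteq> ln (cmod \<beta>)" using z by auto
  then have nz: "1 + E z' \<noteq> 0" by (intro one_plus_E_nonzero) (simp add: norm_E)
  then have zP: "z' \<notin> Poles" by (simp add: Poles_def)
  have "(q - u) * (1 + E z') = z' - 1 - u" using z'(2) by (simp add: algebra_simps)
  with F_eq[OF zP] have "(F z' - u) * (1 + E z') = (q - u) * (1 + E z')" by simp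
  then have "F z' = q" using nz by simp
  then show thesis using that z'(1) zP q(1) by blast
qed

text \<open>Here \<open>E z\<close> is large, so a target \<open>q\<close> is nearly balanced if
  \<open>|q - u|\<close> is about \<open>r = |z - 1 - u| / |E z|\<close>. The point \<open>y\<close>
  is chosen on that circle with \<open>|E y| = 1 / r\<close>, hence near a critical point.\<close>

lemma preimage_of_Crit_left:
  assumes z: "Re z \<le> ln (cmod \<beta>) - 20"
    and far: "cmod (F z - u) \<ge> 300 + 4 * \<bar>ln (cmod \<beta>) - Re u\<bar>"
  obtains z' where "cmod (z' - z) \<le> 15" "z' \<notin> Poles" "F z' \<in> Crit"
proof -
  define x0 where "x0 = ln (cmod \<beta>)"
  have "20 \<le> ln (cmod \<beta>) - Re z" using z by simp
  then have "1 + 20 \<le> exp (ln (cmod \<beta>) - Re z)"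
    using exp_ge_add_one_self[of "ln (cmod \<beta>) - Re z"] by linarith
  then have E: "21 \<le> cmod (E z)" by (simp add: norm_E)
  then have nz: "1 + E z \<noteq> 0" by (intro one_plus_E_nonzero) auto
  define r where "r = cmod (z - 1 - u) / cmod (E z)"
  have zP: "z \<notin> Poles" using nz by (simp add: Poles_def)
  have "cmod (F z - u) * cmod (1 + E z) = cmod (z - 1 - u)"
    using F_eq[OF zP] by (metis norm_mult)
  moreover have "cmod (E z) \<le> 2 * cmod (1 + E z)"
    using norm_triangle_ineq4[of "1 + E z" 1] E by simp
  then have "cmod (F z - u) * cmod (E z) \<le> cmod (F z - u) * (2 * cmod (1 + E z))"
    by (intro mult_left_mono) auto
  ultimately have "cmod (F z - u) * cmod (E z) \<le> 2 * cmod (z - 1 - u)"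
    by linarith
  then have "cmod (F z - u) \<le> 2 * cmod (z - 1 - u) / cmod (E z)"
    using E by (subst pos_le_divide_eq) auto
  then have "cmod (F z - u) \<le> 2 * r" by (simp add: r_def)
  define a where "a = \<bar>x0 - Re u\<bar>"
  have "300 + 4 * a \<le> 2 * r"
    using far \<open>cmod (F z - u) \<le> 2 * r\<close> unfolding a_def x0_def by (rule order_trans)
  moreover have "0 \<le> a" by (simp add: a_def)
  ultimately have r: "150 \<le> r" "2 * a \<le> r" by linarith+
  have zu: "cmod (z - 1 - u) = r * cmod (E z)" using E by (auto simp: r_def)
  \<comment> \<open>The vertical line where \<open>|E y| = 1 / r\<close> lies at signed distance
    \<open>d\<close> from \<open>u\<close>, so it meets the circle once
    \<open>|d| \<le> r\<close>.\<close>
  define d where "d = x0 + ln r - Re u"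
  have "ln (r / 2) \<le> r / 2 - 1" using r by (intro ln_le_minus_one) simp
  moreover have "ln (2 :: real) \<le> 1" using ln_le_minus_one[of 2] by simp
  moreover have "ln (r / 2) = ln r - ln 2" using r by (simp add: ln_div)
  moreover have "0 \<le> ln r" using r by simp
  moreover have "\<bar>d\<bar> \<le> a + \<bar>ln r\<bar>"
    using abs_triangle_ineq[of "x0 - Re u" "ln r"] by (simp add: d_def a_def algebra_simps)
  ultimately have "\<bar>d\<bar> \<le> r" using r by simp
  then have d2: "d\<^sup>2 \<le> r\<^sup>2" by (metis abs_ge_zero power2_abs power_mono)
  define y where "y = u + Complex d (sqrt (r\<^sup>2 - d\<^sup>2))"
  have yr: "cmod (y - u) = r" using d2 r by (simp add: y_def cmod_def)
  have "Re y = x0 + ln r" by (simp add: y_def d_def)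
  then have "cmod (E y) = exp (- ln r)" by (simp add: norm_E x0_def)
  then have Ey: "cmod (E y) * cmod (y - u) = 1" using yr r by (simp add: exp_minus)
  have "z - 1 - y = (z - 1 - u) - (y - u)" "z - 1 - u = (z - 1 - y) + (y - u)" by simp_all
  then have "cmod (z - 1 - y) \<le> r * cmod (E z) + r" "r * cmod (E z) \<le> cmod (z - 1 - y) + r"
    by (metis norm_triangle_ineq norm_triangle_ineq4 yr zu)+
  moreover have "21 * r \<le> r * cmod (E z)" using E r by (simp add: mult.commute)
  ultimately have zy: "cmod (z - 1 - y) \<le> 2 * (r * cmod (E z))" "r * cmod (E z) \<le> 2 * cmod (z - 1 - y)"
    "66 \<le> cmod (z - 1 - y)"
    using r(1) by linarith+
  have Er: "0 \<le> r * cmod (E z)" using r(1) by simp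
  show thesis
  proof (rule preimage_of_Crit[of z y])
    show "\<bar>Re z - ln (cmod \<beta>)\<bar> > 15" using z by simp
    show "24 \<le> cmod (y - u)" using yr r by simp
    show "cmod (z - 1 - y) \<le> 300 * (cmod (E z) * cmod (y - u))"
      unfolding yr mult.commute[of "cmod (E z)" r] using zy(1) Er by linarith
    show "cmod (E z) * cmod (y - u) \<le> 300 * cmod (z - 1 - y)"
      unfolding yr mult.commute[of "cmod (E z)" r] using zy(2) norm_ge_zero[of "z - 1 - y"] by linarith
  qed (use Ey zy(3) that in auto)
qed

text \<open>Here \<open>E z\<close> is small. For \<open>y\<close> with \<open>|y - u|\<close>
  comparable to \<open>t = |z - u|\<close>, balance requires \<open>|z - 1 - y|\<close> to be
  comparable to \<open>m\<close>. So \<open>y\<close> is placed on a circle about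
  \<open>z - 1\<close> where it crosses the line \<open>|E y| = 1 / t\<close>.\<close>

lemma preimage_of_Crit_right:
  assumes z: "Re z \<ge> ln (cmod \<beta>) + 20"
    and t: "400 \<le> cmod (z - u)" and m: "1/2 \<le> cmod (z - u) * cmod (E z)"
  obtains z' where "cmod (z' - z) \<le> 15" "z' \<notin> Poles" "F z' \<in> Crit"
proof -
  define x0 where "x0 = ln (cmod \<beta>)"
  define t where "t = cmod (z - u)"
  define m where "m = t * cmod (E z)"
  \<comment> \<open>Enlarged to the distance that \<open>preimage_of_Crit\<close> demands; as
    \<open>m\<close> is at least 1/2, the factor lost is at most 132.\<close>
  define m' where "m' = max m 66"
  have t400: "400 \<le> t" using assms(2) by (simp add: t_def)
  have m12: "1/2 \<le> m" using assms(3) by (simp add: m_def t_def)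
  have "cmod (E z) * 21 \<le> 1" using E_small[OF z] by simp
  then have "t * (cmod (E z) * 21) \<le> t * 1" using t400 by (intro mult_left_mono) auto
  then have mt: "21 * m \<le> t" by (simp add: m_def algebra_simps)
  then have m't: "m' + 1 \<le> t / 4" using t400 by (simp add: m'_def)
  \<comment> \<open>The real part of \<open>y - (z - 1)\<close>. It equals \<open>ln m + 1\<close>,
    which is at most \<open>m'\<close> in modulus, so the line meets the circle.\<close>
  define d where "d = x0 + ln t - Re z + 1"
  have lnm: "ln m = ln t + (x0 - Re z)"
    using t400 by (simp add: m_def norm_E x0_def ln_mult)
  then have d: "d = ln m + 1" by (simp add: d_def)
  have "ln m \<le> m - 1" using m12 by (intro ln_le_minus_one) simp
  moreover have "ln (1 / m) \<le> 1 / m - 1" using m12 by (intro ln_le_minus_one) simp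
  moreover have "1 / m \<le> 2" using m12 by (simp add: field_simps)
  moreover have "ln (1 / m) = - ln m" using m12 by (simp add: ln_div)
  ultimately have "\<bar>d\<bar> \<le> m'" unfolding d m'_def by linarith
  then have d2: "d\<^sup>2 \<le> m'\<^sup>2" by (metis abs_ge_zero power2_abs power_mono)
  define y where "y = z - 1 + Complex d (sqrt (m'\<^sup>2 - d\<^sup>2))"
  have m'0: "66 \<le> m'" by (simp add: m'_def)
  have "cmod (y - (z - 1)) = m'" using d2 m'0 by (simp add: y_def cmod_def)
  then have zy: "cmod (z - 1 - y) = m'" by (metis norm_minus_commute)
  have "y - u = (z - u) - (1 + (z - 1 - y))" "z - u = (y - u) + (1 + (z - 1 - y))" by simp_all
  then have "cmod (y - u) \<le> t + cmod (1 + (z - 1 - y))" "t \<le> cmod (y - u) + cmod (1 + (z - 1 - y))"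
    unfolding t_def by (metis norm_triangle_ineq norm_triangle_ineq4)+
  moreover have "cmod (1 + (z - 1 - y)) \<le> 1 + m'"
    using norm_triangle_ineq[of 1 "z - 1 - y"] zy by simp
  ultimately have yu: "cmod (y - u) \<le> 2 * t" "t \<le> 2 * cmod (y - u)"
    using m't t400 by linarith+
  have "Re y = x0 + ln t" by (simp add: y_def d_def)
  then have "cmod (E y) = exp (- ln t)" by (simp add: norm_E x0_def)
  then have Ey: "cmod (E y) * cmod (y - u) = cmod (y - u) / t" using t400 by (simp add: exp_minus divide_inverse)
  have k: "cmod (E z) * cmod (y - u) \<le> 2 * m" "m \<le> 2 * (cmod (E z) * cmod (y - u))"
    using yu mult_left_mono[of "cmod (y - u)" "2 * t" "cmod (E z)"] mult_left_mono[of t "2 * cmod (y - u)" "cmod (E z)"]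
    by (simp_all add: m_def algebra_simps)
  have mm: "m \<le> m'" "m' \<le> 132 * m" using m12 by (auto simp: m'_def)
  show thesis
  proof (rule preimage_of_Crit[of z y])
    show "\<bar>Re z - ln (cmod \<beta>)\<bar> > 15" using z by simp
    show "24 \<le> cmod (y - u)" using yu t400 by linarith
    show "1/2 \<le> cmod (E y) * cmod (y - u)" "cmod (E y) * cmod (y - u) \<le> 2"
      unfolding Ey using yu t400 by (simp_all add: field_simps)
    show "66 \<le> cmod (z - 1 - y)" using zy m'0 by simp
    show "cmod (z - 1 - y) \<le> 300 * (cmod (E z) * cmod (y - u))"
      unfolding zy using k mm by linarith
    show "cmod (E z) * cmod (y - u) \<le> 300 * cmod (z - 1 - y)"
      unfolding zy using k mm m'0 by linarith
  qed (use that in auto)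
qed

text \<open>The Newton step \<open>z - F z\<close> is within 3/4 of 1 in this region.\<close>

lemma drift_left:
  assumes z: "Re z \<ge> ln (cmod \<beta>) + 20" and m: "cmod (z - u) * cmod (E z) \<le> 1/2"
  shows "Re (F z) \<le> Re z - 1/4"
proof -
  have E: "cmod (E z) \<le> 1/21" using E_small[OF z] by simp
  have q: "20/21 \<le> cmod (1 + E z)" using norm_triangle_ineq4[of "1 + E z" "E z"] E by simp
  then have nz: "1 + E z \<noteq> 0" by auto
  define D where "D = (1 + (z - u) * E z) / (1 + E z)"
  have FD: "F z = z - D" using nz by (simp add: F_def D_def field_simps)
  have "D - 1 = ((z - u) * E z - E z) / (1 + E z)" using nz by (simp add: D_def field_simps)
  then have "cmod (D - 1) = cmod ((z - u) * E z - E z) / cmod (1 + E z)" by (simp add: norm_divide)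
  also have "\<dots> \<le> (1/2 + 1/21) / (20/21)"
    using norm_triangle_ineq4[of "(z - u) * E z" "E z"] m E q
    by (intro frac_le) (auto simp: norm_mult)
  finally have "cmod (D - 1) \<le> 3/4" by simp
  then have "\<bar>Re D - 1\<bar> \<le> 3/4" using abs_Re_le_cmod[of "D - 1"] by simp
  then show ?thesis unfolding FD minus_complex.sel by linarith
qed

lemma no_uniform_escape_from_boundary:
  assumes x: "x \<in> Fatou_fin" and dist: "\<And>m n. m \<noteq> n \<Longrightarrow> fatou_comp ((F ^^ m) x) \<noteq> fatou_comp ((F ^^ n) x)"
    and far: "\<And>R. R > 0 \<Longrightarrow> \<forall>\<^sub>F n in sequentially. ball ((F ^^ n) x) R \<subseteq> Fatou_fin"
  shows False
proof -
  obtain p0 where p0: "p0 \<in> Poles" by (rule pole_near)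
  define K where "K = 400 + 4 * \<bar>ln (cmod \<beta>) - Re u\<bar>"
  \<comment> \<open>A Fatou disc contains no pole. Radius \<open>R\<close> therefore keeps the orbit
    at distance \<open>K\<close> from \<open>u\<close>, through \<open>p0\<close>, and out of a
    strip about the line of poles, through a pole at similar height.\<close>
  define R where "R = K + cmod (p0 - u) + 30"
  have K: "400 \<le> K" by (simp add: K_def)
  have R: "430 \<le> R" using K norm_ge_zero[of "p0 - u"] unfolding R_def by linarith
  obtain n0 where n0: "\<And>n. n \<ge> n0 \<Longrightarrow> ball ((F ^^ n) x) R \<subseteq> Fatou_fin"
    using far[of R] R by (auto simp: eventually_sequentially)
  \<comment> \<open>A critical point is fixed, so it would lie in the components of both the next
    orbit point and the one after.\<close>
  have excl: "F z' \<notin> Crit" if n: "n \<ge> n0" and z': "cmod (z' - (F ^^ n) x) \<le> 15" for n z'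
  proof
    assume Crit: "F z' \<in> Crit"
    have "ball ((F ^^ n) x) R \<subseteq> fatou_comp ((F ^^ n) x)"
      using n0[OF n] R by (intro fatou_comp_maximal) auto
    moreover have "z' \<in> ball ((F ^^ n) x) R" using z' R by (simp add: dist_norm norm_minus_commute)
    ultimately have z'c: "z' \<in> fatou_comp ((F ^^ n) x)" by blast
    have zFK: "(F ^^ n) x \<in> Fatou_fin" using x by (rule Fatou_fin_funpow)
    have "F z' \<in> fatou_comp ((F ^^ Suc n) x)"
      using fatou_comp_image[OF zFK, of 1] z'c by auto
    moreover have "F z' = F (F z')" using Crit_fixed[OF Crit] by simp
    then have "F z' \<in> fatou_comp ((F ^^ Suc (Suc n)) x)"
      using fatou_comp_image[OF zFK, of 2] z'c by (auto simp: numeral_2_eq_2)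
    ultimately have "fatou_comp ((F ^^ Suc n) x) = fatou_comp ((F ^^ Suc (Suc n)) x)"
      using fatou_comp_eq by metis
    with dist show False by (metis n_not_Suc_n)
  qed
  have big: "K \<le> cmod ((F ^^ n) x - u)" "20 < \<bar>Re ((F ^^ n) x) - ln (cmod \<beta>)\<bar>" if n: "n \<ge> n0" for n
  proof -
    define z where "z = (F ^^ n) x"
    have out: "R \<le> cmod (z - p)" if "p \<in> Poles" for p
    proof (rule ccontr)
      assume "\<not> ?thesis"
      then have "p \<in> ball z R" by (simp add: dist_norm)
      then have "p \<in> Fatou_fin" using n0[OF n] by (auto simp: z_def)
      then show False using Fatou_fin_not_Poles that by blast
    qed
    have "cmod (z - p0) \<le> cmod (z - u) + cmod (p0 - u)"
      using norm_triangle_ineq4[of "z - u" "p0 - u"] by simp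
    then show "K \<le> cmod ((F ^^ n) x - u)" using out[OF p0] by (simp add: R_def z_def)
    obtain p where p: "p \<in> Poles" "Re p = ln (cmod \<beta>)" "\<bar>Im p - Im z\<bar> \<le> 2 * pi" by (rule pole_near)
    have "R \<le> \<bar>Re z - ln (cmod \<beta>)\<bar> + \<bar>Im p - Im z\<bar>"
      using out[OF p(1)] cmod_le[of "z - p"] p(2) by (simp add: abs_minus_commute)
    then show "20 < \<bar>Re ((F ^^ n) x) - ln (cmod \<beta>)\<bar>"
      using p(3) pi_less_4 R by (simp add: z_def)
  qed
  have right: "Re ((F ^^ n) x) \<ge> ln (cmod \<beta>) + 20" if n: "n \<ge> n0" for n
  proof (rule ccontr)
    assume "\<not> ?thesis"
    then have "Re ((F ^^ n) x) \<le> ln (cmod \<beta>) - 20" using big(2)[OF n] by linarith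
    \<comment> \<open>The lower bound on the distance to \<open>u\<close> is taken at the next orbit
      point.\<close>
    moreover have "300 + 4 * \<bar>ln (cmod \<beta>) - Re u\<bar> \<le> cmod (F ((F ^^ n) x) - u)"
      using big(1)[of "Suc n"] n by (simp add: K_def)
    ultimately obtain z' where "cmod (z' - (F ^^ n) x) \<le> 15" "F z' \<in> Crit"
      using preimage_of_Crit_left by blast
    then show False using excl[OF n] by blast
  qed
  have step: "Re ((F ^^ Suc n) x) \<le> Re ((F ^^ n) x) - 1/4" if n: "n \<ge> n0" for n
  proof -
    have "\<not> 1/2 \<le> cmod ((F ^^ n) x - u) * cmod (E ((F ^^ n) x))"
    proof
      assume "1/2 \<le> cmod ((F ^^ n) x - u) * cmod (E ((F ^^ n) x))"
      moreover have "400 \<le> cmod ((F ^^ n) x - u)" using big(1)[OF n] K by linarith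
      ultimately obtain z' where "cmod (z' - (F ^^ n) x) \<le> 15" "F z' \<in> Crit"
        using preimage_of_Crit_right[OF right[OF n]] by blast
      then show False using excl[OF n] by blast
    qed
    then show ?thesis using drift_left[OF right[OF n]] by simp
  qed
  have dec: "Re ((F ^^ (n0 + k)) x) \<le> Re ((F ^^ n0) x) - real k / 4" for k
  proof (induction k)
    case (Suc k)
    have "Re ((F ^^ Suc (n0 + k)) x) \<le> Re ((F ^^ (n0 + k)) x) - 1/4" by (rule step) simp
    with Suc show ?case by (simp add: field_simps)
  qed simp
  \<comment> \<open>After \<open>k\<close> steps of length 1/4 the orbit would have crossed the line
    of poles, contradicting \<open>right\<close>.\<close>
  obtain k :: nat where "4 * (Re ((F ^^ n0) x) - ln (cmod \<beta>)) < real k"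
    using reals_Archimedean2 by blast
  then show False using dec[of k] right[of "n0 + k"] by simp
qed

end

subsection \<open>Absence of wandering domains\<close>

context newton_exp
begin

lemma eventually_one_plus_E_nonzero: "\<forall>\<^sub>F w in at z. 1 + E w \<noteq> 0"
proof (cases "1 + E z = 0")
  case True
  then show ?thesis
    unfolding eventually_at using E_ne_minus_1_near[OF True] by (intro exI[of _ 6]) auto
next
  case False
  have "((\<lambda>w. 1 + E w) \<longlongrightarrow> 1 + E z) (at z)"
    unfolding E_def by (intro tendsto_intros)
  then show ?thesis using False by (rule tendsto_imp_eventually_ne)
qed

text \<open>At a zero of \<open>1 + E\<close> the numerator is \<open>z - 1 - u\<close>, so there is
  a genuine pole unless \<open>z = u + 1\<close>. Elsewhere the formula has the limit
  \<open>F z\<close> by continuity.\<close>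

lemma sphere_map_eq_N_sphere: "sphere_map (\<lambda>z. (z - 1 + u * \<beta> * exp (- z)) / (1 + \<beta> * exp (- z))) = N_sphere"
proof
  fix z
  define g where "g = (\<lambda>z. (z - 1 + u * \<beta> * exp (- z)) / (1 + \<beta> * exp (- z)))"
  have gE: "g w = (w - 1 + u * E w) / (1 + E w)" for w
    by (simp add: g_def E_def mult.assoc)
  have gF: "g w = F w" if "1 + E w \<noteq> 0" for w
    using that by (simp add: gE F_def field_simps)
  show "sphere_map g z = N_sphere z"
  proof (cases "z \<in> Poles")
    case True
    then have E1: "1 + E z = 0" and z: "z \<noteq> u + 1" by (auto simp: Poles_def)
    have "is_pole (\<lambda>w. (w - 1 + u * E w) / (1 + E w)) z"
    proof (rule is_pole_divide)
      show "isCont (\<lambda>w. w - 1 + u * E w) z"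
        unfolding E_def by (intro continuous_intros)
      have "((\<lambda>w. 1 + E w) \<longlongrightarrow> 1 + E z) (at z)"
        unfolding E_def by (intro tendsto_intros)
      then show "filterlim (\<lambda>w. 1 + E w) (at 0) (at z)"
        using E1 eventually_one_plus_E_nonzero by (simp add: filterlim_at)
      have "E z = - 1" using E1 by (simp add: add_eq_0_iff)
      then show "z - 1 + u * E z \<noteq> 0" using z by (simp add: algebra_simps)
    qed
    then have "is_pole g z" by (simp add: gE[abs_def])
    then show ?thesis using True by (simp add: sphere_map_def N_sphere_def)
  next
    case False
    have "F \<midarrow>z\<rightarrow> F z"
      using F_continuous open_Compl_Poles False by (simp add: continuous_on_eq_continuous_at isCont_def)
    moreover have "\<forall>\<^sub>F w in at z. F w = g w"
      using eventually_one_plus_E_nonzero by eventually_elim (simp add: gF)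
    ultimately have lim: "g \<midarrow>z\<rightarrow> F z" by (rule Lim_transform_eventually)
    then have "\<not> is_pole g z"
      unfolding is_pole_def using not_tendsto_and_filterlim_at_infinity[of "at z" g "F z"] by auto
    moreover have "remove_sings g z = F z" using lim by (rule remove_sings_eqI)
    ultimately show ?thesis using False by (simp add: sphere_map_def N_sphere_def)
  qed
qed

text \<open>A critical point in the component is fixed, which would make the component equal to its
  successor.\<close>

lemma fatou_comp_subset_Regular:
  assumes y: "y \<in> Fatou_fin" and ne: "fatou_comp (F y) \<noteq> fatou_comp y" and u: "u \<notin> fatou_comp y"
  shows "fatou_comp y \<subseteq> Regular"
proof
  fix p assume p: "p \<in> fatou_comp y"
  have "p \<notin> Crit"
  proof
    assume "p \<in> Crit"
    then have "F p = p" by (rule Crit_fixed)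
    then have "p \<in> fatou_comp (F y)" using fatou_comp_image[OF y, of 1] p by force
    with p ne show False using fatou_comp_eq by metis
  qed
  then show "p \<in> Regular" using p u by (auto simp: Regular_def)
qed

lemma no_wandering_domain:
  assumes uK: "u \<in> Surviving" and inf: "(INF n. infdist ((F ^^ n) u) (- Fatou_fin)) > 0"
  shows "\<not> wandering_domain N_sphere U"
proof
  assume "wandering_domain N_sphere U"
  then obtain x where x: "x \<in> Fatou_fin"
    and ne: "\<And>m n. m \<noteq> n \<Longrightarrow> fatou_comp ((F ^^ m) x) \<noteq> fatou_comp ((F ^^ n) x)"
    using wandering_imp by blast
  \<comment> \<open>Distinct components are disjoint, so \<open>u\<close> lies in at most one of
    them; the orbit is restarted so that all later components avoid \<open>u\<close>.\<close>
  obtain k where k: "\<And>m. m \<ge> 1 \<Longrightarrow> u \<notin> fatou_comp ((F ^^ (m + k)) x)"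
  proof (cases "\<exists>k. u \<in> fatou_comp ((F ^^ k) x)")
    case True
    then obtain k where k: "u \<in> fatou_comp ((F ^^ k) x)" by blast
    show thesis
    proof (rule that[of k])
      fix m :: nat assume "m \<ge> 1"
      then have "fatou_comp ((F ^^ (m + k)) x) \<noteq> fatou_comp ((F ^^ k) x)" by (intro ne) simp
      then show "u \<notin> fatou_comp ((F ^^ (m + k)) x)" using k fatou_comp_eq by metis
    qed
  qed auto
  define y where "y = (F ^^ k) x"
  have y: "y \<in> Fatou_fin" unfolding y_def using x by (rule Fatou_fin_funpow)
  have yx: "(F ^^ m) y = (F ^^ (m + k)) x" for m by (simp add: y_def funpow_add)
  have ney: "fatou_comp ((F ^^ m) y) \<noteq> fatou_comp ((F ^^ n) y)" if "m \<noteq> n" for m n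
    unfolding yx using that by (intro ne) simp
  have CY: "fatou_comp ((F ^^ m) y) \<subseteq> Regular" if "m \<ge> 1" for m
  proof (rule fatou_comp_subset_Regular)
    show "(F ^^ m) y \<in> Fatou_fin" using y by (rule Fatou_fin_funpow)
    show "fatou_comp (F ((F ^^ m) y)) \<noteq> fatou_comp ((F ^^ m) y)" using ney[of "Suc m" m] by simp
    show "u \<notin> fatou_comp ((F ^^ m) y)" unfolding yx using that by (rule k)
  qed
  define \<delta>1 where "\<delta>1 = (INF n. infdist ((F ^^ n) u) (- Fatou_fin))"
  have "bdd_below (range (\<lambda>n. infdist ((F ^^ n) u) (- Fatou_fin)))"
    by (rule bdd_belowI[of _ 0]) (auto simp: infdist_nonneg)
  then have \<delta>1: "\<delta>1 \<le> infdist ((F ^^ n) u) (- Fatou_fin)" for n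
    unfolding \<delta>1_def by (intro cINF_lower) auto
  have b1: "ball ((F ^^ n) u) \<delta>1 \<subseteq> Fatou_fin" for n
  proof
    fix b assume b: "b \<in> ball ((F ^^ n) u) \<delta>1"
    show "b \<in> Fatou_fin"
    proof (rule ccontr)
      assume "b \<notin> Fatou_fin"
      then have "infdist ((F ^^ n) u) (- Fatou_fin) \<le> dist ((F ^^ n) u) b" by (intro infdist_le) simp
      with b \<delta>1[of n] show False by simp
    qed
  qed
  obtain \<delta>2 where \<delta>2: "\<delta>2 > 0" "\<And>p. p \<in> Crit \<Longrightarrow> ball p \<delta>2 \<subseteq> Fatou_fin"
    using Crit_ball_Fatou_fin by blast
  define \<delta> where "\<delta> = min \<delta>1 \<delta>2"
  have "\<delta> > 0" using inf \<delta>2(1) by (simp add: \<delta>_def \<delta>1_def)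
  moreover have "ball p \<delta> \<subseteq> Fatou_fin" if "p \<in> Crit" for p
    using \<delta>2(2)[OF that] subset_ball[of \<delta> \<delta>2 p] by (auto simp: \<delta>_def)
  moreover have "ball ((F ^^ n) u) \<delta> \<subseteq> Fatou_fin" for n
    using b1[of n] subset_ball[of \<delta> \<delta>1 "(F ^^ n) u"] by (auto simp: \<delta>_def)
  ultimately have "\<forall>\<^sub>F n in sequentially. ball ((F ^^ n) y) R \<subseteq> Fatou_fin" if "R > 0" for R
    using distance_to_boundary_tends_to_infinity[OF y CY _ _ _ that] by blast
  then show False using no_uniform_escape_from_boundary[OF y ney] by blast
qed

end

theorem theoremD:
  fixes a b c u :: complex
    and h :: "complex \<Rightarrow> complex"
    and N :: "complex \<Rightarrow> riemann_sphere"
  assumes "a \<noteq> 0" and "b \<noteq> 0"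
    and "h = (\<lambda>z. a * exp z + b * z + c)"
    and "N = newton_map h"
    and "u = - c / b"
    and "\<forall>n. iter N n (Fin u) \<noteq> Infty"
    and "(INF n. infdist (fin_part (iter N n (Fin u))) {z. Fin z \<in> Julia N}) > 0"
  shows "\<not> (\<exists>U. wandering_domain N U)"
proof -
  interpret newton_exp "b / a" u
    using assms(1,2) by unfold_locales simp
  \<comment> \<open>The coefficient \<open>- c / a\<close> is \<open>u * (b / a)\<close>, which
    brings the formula to the form with parameters \<open>\<beta> = b / a\<close> and
    \<open>u\<close>.\<close>
  have num: "z - 1 - c / a * exp (- z) = z - 1 + u * (b / a) * exp (- z)" for z
    using assms(1,2,5) by (simp add: field_simps)
  then have N: "N = N_sphere"
    unfolding assms(4,3) newton_map_exp_plus_linear[OF assms(1)] by (simp only: num sphere_map_eq_N_sphere)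
  have uK: "u \<in> Surviving" using assms(6) by (simp add: Surviving_iff_iter N)
  have "(INF n. infdist ((F ^^ n) u) (- Fatou_fin)) > 0"
    using assms(7) by (simp add: N Julia_eq iter_N_sphere_Surviving[OF uK])
  with uK show ?thesis unfolding N using no_wandering_domain by blast
qed

end
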